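(* Let $p$ be a positive integer, $\alpha\in\mathbb{C}^*$, $U(t)\in\mathbb{C}\{t\}$ with $U(0)=1$, and let $f:(\mathbb{C}^2,\mathbf{0})\to(\mathbb{C},0)$ be a germ of a nonzero holomorphic function. The foliation in $(\mathbb{C}^3,\mathbf{0})$ defined by the 1-form $$\Omega=d\big(z^2+f(x,y)^{2p}\big)+\alpha f(x,y)^pU(f(x,y))\,dz$$ is dicritical if and only if the 1-form $$\omega=d(z^2+t^{2p})+\alpha t^pU(t)\,dz$$ defines a dicritical foliation in $(\mathbb{C}^2,\mathbf{0})$ (with coordinates $(t,z)$).
   Context: A germ of singular holomorphic codimension one foliation $\mathcal{F}$ in $(\mathbb{C}^n,\mathbf{0})$, generated by an integrable holomorphic 1-form $\omega$, is called dicritical if there exists a germ of analytic map $\varphi:(\mathbb{C}^2,\mathbf{0})\to(\mathbb{C}^n,\mathbf{0})$ (coordinates $(x,y)$ in the source) such that: $\varphi$ is not invariant by $\mathcal{F}$, i.e. $\varphi^*\omega\not\equiv0$; the foliation $\varphi^*\mathcal{F}$ (generated by $\varphi^*\omega$ after dividing by common factors of its coefficients) is the foliation $(dx=0)$; and $\varphi(\{y=0\})$ is invariant by $\mathcal{F}$, i.e. the pull-back of $\omega$ by $x\mapsto\varphi(x,0)$ vanishes identically. $\mathbb{C}\{t\}$ denotes the ring of convergent power series. *)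

theory Defs
  imports "HOL-Analysis.Analysis"
begin

text \<open>
  Germs at the origin of complex n-space are represented by functions on all of
  \<open>complex ^ 'n\<close>; only their values near \<open>0\<close> matter, and equality of germs is
  equality eventually in \<open>nhds 0\<close>.
\<close>

definition hol_germ :: "(complex ^ 'n \<Rightarrow> complex) \<Rightarrow> bool" where
  "hol_germ f \<longleftrightarrow>
    (\<forall>\<^sub>F q in nhds 0. \<exists>D. (f has_derivative D) (at q) \<and> (\<forall>c v. D (c *s v) = c * D v))"

definition hol_map_germ :: "(complex ^ 'm \<Rightarrow> complex ^ 'n) \<Rightarrow> bool" where
  "hol_map_germ \<phi> \<longleftrightarrow> (\<forall>i. hol_germ (\<lambda>q. \<phi> q $ i)) \<and> \<phi> 0 = 0"

definition pd :: "'n \<Rightarrow> (complex ^ 'n \<Rightarrow> complex) \<Rightarrow> complex ^ 'n \<Rightarrow> complex" where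
  "pd j g q = deriv (\<lambda>s. g (q + s *s axis j 1)) 0"

text \<open>
  A 1-form is given by its coefficient vector: \<open>\<omega> q $ i\<close> is the coefficient of the
  differential of the i-th coordinate at the point \<open>q\<close>.
\<close>

type_synonym 'n form = "complex ^ 'n \<Rightarrow> complex ^ 'n"

definition hol_form :: "'n::finite form \<Rightarrow> bool" where
  "hol_form \<omega> \<longleftrightarrow> (\<forall>i. hol_germ (\<lambda>q. \<omega> q $ i))"

definition differential :: "(complex ^ 'n \<Rightarrow> complex) \<Rightarrow> 'n::finite form" where
  "differential g = (\<lambda>q. \<chi> j. pd j g q)"

definition pullback :: "(complex ^ 'm \<Rightarrow> complex ^ 'n) \<Rightarrow> 'n::finite form \<Rightarrow> 'm::finite form" where
  "pullback \<phi> \<omega> = (\<lambda>q. \<Sum>i\<in>UNIV. (\<omega> (\<phi> q) $ i) *s differential (\<lambda>q. \<phi> q $ i) q)"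

definition form_zero :: "'n::finite form \<Rightarrow> bool" where
  "form_zero \<omega> \<longleftrightarrow> (\<forall>\<^sub>F q in nhds 0. \<omega> q = 0)"

text \<open>The components of \<open>\<omega> \<and> d\<omega>\<close> vanish.\<close>

definition integrable_form :: "'n::finite form \<Rightarrow> bool" where
  "integrable_form \<omega> \<longleftrightarrow>
    (let d\<omega> = (\<lambda>i j q. pd i (\<lambda>q. \<omega> q $ j) q - pd j (\<lambda>q. \<omega> q $ i) q) in
     \<forall>i j k. \<forall>\<^sub>F q in nhds 0.
       \<omega> q $ i * d\<omega> j k q + \<omega> q $ j * d\<omega> k i q + \<omega> q $ k * d\<omega> i j q = 0)"

definition foliation_form :: "'n::finite form \<Rightarrow> bool" where
  "foliation_form \<omega> \<longleftrightarrow> hol_form \<omega> \<and> integrable_form \<omega> \<and> \<not> form_zero \<omega>"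

definition germ_dvd :: "(complex ^ 'n \<Rightarrow> complex) \<Rightarrow> (complex ^ 'n \<Rightarrow> complex) \<Rightarrow> bool" where
  "germ_dvd d h \<longleftrightarrow> (\<exists>e. hol_germ e \<and> (\<forall>\<^sub>F q in nhds 0. h q = d q * e q))"

text \<open>A holomorphic germ \<open>d\<close> is a unit iff \<open>d 0 \<noteq> 0\<close>.\<close>

definition no_common_factor :: "'n::finite form \<Rightarrow> bool" where
  "no_common_factor \<eta> \<longleftrightarrow>
    (\<forall>d. hol_germ d \<and> (\<forall>i. germ_dvd d (\<lambda>q. \<eta> q $ i)) \<longrightarrow> d 0 \<noteq> 0)"

text \<open>\<open>\<eta>\<close> is \<open>\<theta>\<close> divided by the common factors of its coefficients.\<close>

definition is_saturation :: "'n::finite form \<Rightarrow> 'n form \<Rightarrow> bool" where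
  "is_saturation \<theta> \<eta> \<longleftrightarrow> hol_form \<eta> \<and> no_common_factor \<eta> \<and>
    (\<exists>g. hol_germ g \<and> (\<forall>\<^sub>F q in nhds 0. \<theta> q = g q *s \<eta> q))"

text \<open>
  Forms without common factors generate the same foliation iff they agree up to a unit.
\<close>

definition same_foliation :: "'n::finite form \<Rightarrow> 'n form \<Rightarrow> bool" where
  "same_foliation \<eta> \<theta> \<longleftrightarrow>
    (\<exists>u. hol_germ u \<and> u 0 \<noteq> 0 \<and> (\<forall>\<^sub>F q in nhds 0. \<eta> q = u q *s \<theta> q))"

text \<open>
  The coordinates of the source are \<open>x = q $ 1\<close> and \<open>y = q $ 2\<close>; the curve
  \<open>x \<mapsto> \<phi>(x, 0)\<close> is parametrized by \<open>complex ^ 1\<close>.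
\<close>

definition dicritical :: "'n::finite form \<Rightarrow> bool" where
  "dicritical \<omega> \<longleftrightarrow> foliation_form \<omega> \<and>
    (\<exists>\<phi> :: complex ^ 2 \<Rightarrow> complex ^ 'n.
       hol_map_germ \<phi> \<and>
       \<not> form_zero (pullback \<phi> \<omega>) \<and>
       (\<exists>\<eta>. is_saturation (pullback \<phi> \<omega>) \<eta> \<and>
            same_foliation \<eta> (differential (\<lambda>q. q $ 1))) \<and>
       form_zero (pullback (\<lambda>s :: complex ^ 1. \<phi> (vector [s $ 1, 0])) \<omega>))"

definition form\<Omega> ::
  "nat \<Rightarrow> complex \<Rightarrow> complex fps \<Rightarrow> (complex ^ 2 \<Rightarrow> complex) \<Rightarrow> 3 form" where
  "form\<Omega> p \<alpha> U f = (\<lambda>q.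
     let F = (\<lambda>q. f (vector [q $ 1, q $ 2])) in
       differential (\<lambda>q. (q $ 3)\<^sup>2 + F q ^ (2 * p)) q
       + (\<alpha> * F q ^ p * eval_fps U (F q)) *s differential (\<lambda>q. q $ 3) q)"

text \<open>Here \<open>t = q $ 1\<close> and \<open>z = q $ 2\<close>.\<close>

definition form\<omega> :: "nat \<Rightarrow> complex \<Rightarrow> complex fps \<Rightarrow> 2 form" where
  "form\<omega> p \<alpha> U = (\<lambda>q.
     differential (\<lambda>q. (q $ 2)\<^sup>2 + (q $ 1) ^ (2 * p)) q
     + (\<alpha> * (q $ 1) ^ p * eval_fps U (q $ 1)) *s differential (\<lambda>q. q $ 2) q)"

end

theory Submission
  imports Defs "HOL-Complex_Analysis.Conformal_Mappings"
begin

text \<open>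
  The form \<open>\<Omega>\<close> is a pull-back of \<open>\<omega>\<close>: with \<open>\<Phi>(x, y, z) = (f(x, y), z)\<close> one has \<open>\<Omega> = \<Phi>\<^sup>* \<omega>\<close>. A
  foliation is dicritical iff some map germ from the plane pulls its form back to \<open>h dx\<close>, where \<open>h\<close> is
  not zero but vanishes on the axis \<open>y = 0\<close> (\<open>dicritical_iff\<close>). If \<open>\<phi>\<close> is such a map for \<open>\<Omega>\<close>, then
  \<open>\<Phi> \<circ> \<phi>\<close> is one for \<open>\<omega>\<close>. This is one implication.

  For the other one, let \<open>\<psi> = (T, Z)\<close> satisfy \<open>\<psi>\<^sup>* \<omega> = h dx\<close>. A lift of \<open>\<psi>\<close> through \<open>\<Phi>\<close> requires \<open>T\<close> to
  factor through \<open>f\<close>. On a suitable curve through the origin \<open>f\<close> is the \<open>k\<close>-th power of a parameter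
  (\<open>germ_is_power_on_curve\<close>), so it suffices to make \<open>T\<close> a \<open>k\<close>-th power by a substitution in the
  source that preserves \<open>dx\<close> up to a factor. Write \<open>h = y\<^sup>n w\<close>, where \<open>n > 0\<close> and \<open>w\<close> is not
  identically zero on the axis. Comparing exterior derivatives in \<open>\<psi>\<^sup>* \<omega> = h dx\<close> shows that \<open>T\<close> and \<open>Z\<close> vanish on the axis
  (\<open>components_vanish_on_axis\<close>). Hence \<open>T = y\<^sup>m v\<close> with \<open>m > 0\<close>, and the base point can be moved along
  the axis to a place \<open>(x0, 0)\<close> where \<open>v\<close> and \<open>w\<close> are units, while \<open>\<psi>\<close> still sends the new base point
  to the origin (\<open>dicritical_pair_normal_form\<close>). After the substitution \<open>y \<mapsto> y\<^sup>k\<close> the function \<open>T\<close> is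
  a \<open>k\<close>-th power, which gives the lift (\<open>dicritical_pair_lift\<close>).

  Holomorphic germs are given by pointwise complex differentiability alone. Cauchy's formula in
  each coordinate direction shows that partial derivatives are again holomorphic and commute
  (\<open>hol_on_pd\<close>, \<open>pd_commute\<close>), and yields the division by \<open>y\<close> (\<open>divide_by_second_coordinate\<close>).
\<close>

section \<open>Complex gradients\<close>

definition has_gradient :: "(complex ^ 'n::finite \<Rightarrow> complex) \<Rightarrow> complex ^ 'n \<Rightarrow> complex ^ 'n \<Rightarrow> bool" where
  "has_gradient f G q \<longleftrightarrow> (f has_derivative (\<lambda>v. \<Sum>i\<in>UNIV. G $ i * v $ i)) (at q)"

definition hol_on :: "(complex ^ 'n::finite) set \<Rightarrow> (complex ^ 'n \<Rightarrow> complex) \<Rightarrow> bool" where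
  "hol_on S f \<longleftrightarrow> (\<forall>q\<in>S. \<exists>G. has_gradient f G q)"

lemma bounded_linear_complex_linear_form:
  "bounded_linear (\<lambda>v::complex^'n::finite. \<Sum>i\<in>UNIV. G $ i * v $ i)"
  by (intro bounded_linear_sum bounded_linear_mult_right[THEN bounded_linear_compose] bounded_linear_vec_nth)

text \<open>
  A real derivative that commutes with complex scalars is a complex linear form, hence given by its
  values on the coordinate vectors. This is the bridge from the definition of a holomorphic germ to
  explicit gradient vectors, for which a calculus can be set up.
\<close>

lemma has_gradient_iff:
  "(\<exists>D. (f has_derivative D) (at q) \<and> (\<forall>c v. D (c *s v) = c * D v)) \<longleftrightarrow> (\<exists>G. has_gradient f G q)"
proof
  assume "\<exists>D. (f has_derivative D) (at q) \<and> (\<forall>c v. D (c *s v) = c * D v)"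
  then obtain D where D: "(f has_derivative D) (at q)" "\<And>c v. D (c *s v) = c * D v" by blast
  have lin: "linear D" using D(1) has_derivative_linear by blast
  have "D v = (\<Sum>i\<in>UNIV. (\<chi> i. D (axis i 1)) $ i * v $ i)" for v
  proof -
    have "v = (\<Sum>i\<in>UNIV. v $ i *s axis i 1)" by (simp add: basis_expansion)
    hence "D v = D (\<Sum>i\<in>UNIV. v $ i *s axis i 1)" by simp
    also have "\<dots> = (\<Sum>i\<in>UNIV. D (v $ i *s axis i 1))" by (rule linear_sum[OF lin])
    finally show ?thesis by (simp add: D(2) mult.commute)
  qed
  hence "D = (\<lambda>v. \<Sum>i\<in>UNIV. (\<chi> i. D (axis i 1)) $ i * v $ i)" by blast
  thus "\<exists>G. has_gradient f G q" using D(1) unfolding has_gradient_def by metis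
next
  assume "\<exists>G. has_gradient f G q"
  thus "\<exists>D. (f has_derivative D) (at q) \<and> (\<forall>c v. D (c *s v) = c * D v)"
    unfolding has_gradient_def by (force simp: sum_distrib_left mult_ac)
qed

lemma hol_germ_iff: "hol_germ f \<longleftrightarrow> (\<forall>\<^sub>F q in nhds 0. \<exists>G. has_gradient f G q)"
  unfolding hol_germ_def has_gradient_iff ..

lemma hol_germ_iff_ball: "hol_germ f \<longleftrightarrow> (\<exists>r>0. hol_on (ball 0 r) f)"
  unfolding hol_germ_iff eventually_nhds_metric hol_on_def Ball_def mem_ball dist_commute[of _ 0] ..

lemma has_gradient_imp_line:
  assumes "has_gradient f G q"
  shows "((\<lambda>s. f (q + s *s v)) has_field_derivative (\<Sum>i\<in>UNIV. G $ i * v $ i)) (at 0)"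
proof -
  have bl: "bounded_linear (\<lambda>s::complex. s *s v)"
  proof
    fix r :: real and b c :: complex
    show "(b + c) *s v = b *s v + c *s v" by (simp add: vec_eq_iff algebra_simps)
    show "(r *\<^sub>R b) *s v = r *\<^sub>R (b *s v)" by (simp add: vec_eq_iff)
    have "norm (s *s v) \<le> norm s * norm v" for s
      by (simp add: norm_vec_def L2_set_right_distrib norm_mult)
    thus "\<exists>K. \<forall>x::complex. norm (x *s v) \<le> norm x * K" by blast
  qed
  have 1: "((\<lambda>s::complex. q + s *s v) has_derivative (\<lambda>s. s *s v)) (at 0)"
    using has_derivative_add[OF has_derivative_const bounded_linear_imp_has_derivative[OF bl]] by simp
  have 2: "(f has_derivative (\<lambda>v. \<Sum>i\<in>UNIV. G $ i * v $ i)) (at (q + 0 *s v))"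
    using assms by (simp add: has_gradient_def)
  have "((\<lambda>s. f (q + s *s v)) has_derivative (\<lambda>s. \<Sum>i\<in>UNIV. G $ i * (s *s v) $ i)) (at 0)"
    using has_derivative_compose[OF 1 2] by simp
  moreover have "(\<lambda>s. \<Sum>i\<in>UNIV. G $ i * (s *s v) $ i) = (*) (\<Sum>i\<in>UNIV. G $ i * v $ i)"
    by (simp add: fun_eq_iff sum_distrib_left mult_ac)
  ultimately show ?thesis unfolding has_field_derivative_def by simp
qed

lemma has_gradient_imp_line_at:
  assumes "has_gradient f G (q + s0 *s v)"
  shows "((\<lambda>s. f (q + s *s v)) has_field_derivative (\<Sum>i\<in>UNIV. G $ i * v $ i)) (at s0)"
proof -
  have "(\<lambda>s. f (q + s *s v)) = (\<lambda>s. f (q + s0 *s v + (s - s0) *s v))"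
    by (simp add: vec.scale_left_diff_distrib)
  moreover have "((\<lambda>s. f (q + s0 *s v + (s - s0) *s v)) has_field_derivative
      (\<Sum>i\<in>UNIV. G $ i * v $ i) * 1) (at s0)"
    by (rule DERIV_chain2[where f = "\<lambda>s. f (q + s0 *s v + s *s v)"])
       (use has_gradient_imp_line[OF assms] in \<open>auto intro!: derivative_eq_intros\<close>)
  ultimately show ?thesis by simp
qed

lemma hol_on_imp_holomorphic_line:
  assumes "hol_on S f" "\<And>s. s \<in> T \<Longrightarrow> q + s *s v \<in> S"
  shows "(\<lambda>s. f (q + s *s v)) holomorphic_on T"
  unfolding holomorphic_on_def
proof
  fix s assume "s \<in> T"
  then obtain G where "has_gradient f G (q + s *s v)"
    using assms unfolding hol_on_def by blast
  thus "(\<lambda>s. f (q + s *s v)) field_differentiable at s within T"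
    using has_gradient_imp_line_at field_differentiable_def field_differentiable_at_within by blast
qed

lemma has_gradient_imp_pd: "has_gradient f G q \<Longrightarrow> pd j f q = G $ j"
  unfolding pd_def
  by (rule DERIV_imp_deriv) (use has_gradient_imp_line[of f G q "axis j 1"] in
    \<open>simp add: axis_def if_distrib cong: if_cong\<close>)

lemma has_gradient_imp_differential: "has_gradient f G q \<Longrightarrow> differential f q = G"
  by (simp add: differential_def has_gradient_imp_pd vec_eq_iff)

lemma has_gradient_differential: "\<exists>G. has_gradient f G q \<Longrightarrow> has_gradient f (differential f q) q"
  using has_gradient_imp_differential by blast

lemma hol_onD: "hol_on S f \<Longrightarrow> q \<in> S \<Longrightarrow> has_gradient f (differential f q) q"
  unfolding hol_on_def by (blast intro: has_gradient_differential)

lemma hol_onI: "(\<And>q. q \<in> S \<Longrightarrow> has_gradient f (G q) q) \<Longrightarrow> hol_on S f"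
  unfolding hol_on_def by blast

lemma hol_on_subset: "hol_on S f \<Longrightarrow> T \<subseteq> S \<Longrightarrow> hol_on T f"
  unfolding hol_on_def by blast

lemma has_gradient_imp_continuous: "has_gradient f G q \<Longrightarrow> continuous (at q) f"
  unfolding has_gradient_def by (rule has_derivative_continuous)

lemma hol_on_imp_continuous_on: "hol_on S f \<Longrightarrow> continuous_on S f"
  unfolding hol_on_def
  by (rule continuous_at_imp_continuous_on) (blast dest: has_gradient_imp_continuous)

lemma has_gradient_const: "has_gradient (\<lambda>_. c) 0 q"
  by (simp add: has_gradient_def)

lemma has_gradient_coordinate: "has_gradient (\<lambda>q. q $ i) (axis i 1) q"
proof -
  have "(\<lambda>v::complex^'a. \<Sum>j\<in>UNIV. axis i 1 $ j * v $ j) = (\<lambda>v. v $ i)"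
    by (simp add: axis_def if_distribR if_distrib[of "\<lambda>c. c * _"] cong: if_cong)
  thus ?thesis unfolding has_gradient_def
    using bounded_linear_imp_has_derivative[OF bounded_linear_vec_nth] by metis
qed

lemma has_gradient_add:
  assumes "has_gradient f F q" "has_gradient g G q"
  shows "has_gradient (\<lambda>q. f q + g q) (F + G) q"
  using has_derivative_add[OF assms[unfolded has_gradient_def]]
  by (simp add: has_gradient_def sum.distrib distrib_right)

lemma has_gradient_mult:
  assumes "has_gradient f F q" "has_gradient g G q"
  shows "has_gradient (\<lambda>q. f q * g q) (f q *s G + g q *s F) q"
proof -
  have "(\<lambda>v. \<Sum>i\<in>UNIV. (f q *s G + g q *s F) $ i * v $ i) =
        (\<lambda>v. f q * (\<Sum>i\<in>UNIV. G $ i * v $ i) + (\<Sum>i\<in>UNIV. F $ i * v $ i) * g q)"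
    by (auto simp: sum.distrib algebra_simps sum_distrib_left sum_distrib_right)
  thus ?thesis using has_derivative_mult[OF assms[unfolded has_gradient_def]]
    by (simp add: has_gradient_def)
qed

lemma has_gradient_field_compose:
  assumes "has_gradient f G q" "(F has_field_derivative d) (at (f q))"
  shows "has_gradient (\<lambda>q. F (f q)) (d *s G) q"
  using has_derivative_compose[OF assms(1)[unfolded has_gradient_def] assms(2)[unfolded has_field_derivative_def]]
  by (simp add: has_gradient_def sum_distrib_left mult_ac)

lemma has_derivative_vec_components:
  fixes \<phi> :: "'a::real_normed_vector \<Rightarrow> complex ^ 'n::finite"
  assumes "\<And>i. ((\<lambda>q. \<phi> q $ i) has_derivative (\<lambda>v. D v $ i)) (at q)"
  shows "(\<phi> has_derivative D) (at q)"
proof -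
  have "((\<lambda>q. \<Sum>i\<in>UNIV. axis i (\<phi> q $ i)) has_derivative (\<lambda>v. \<Sum>i\<in>UNIV. axis i (D v $ i))) (at q)"
  proof (intro has_derivative_sum)
    fix i
    have "bounded_linear (axis i :: complex \<Rightarrow> complex ^ 'n)"
    proof
      fix r :: real and b c :: complex
      show "axis i (b + c) = axis i b + (axis i c :: complex ^ 'n)" by (simp add: vec_eq_iff axis_def)
      show "axis i (r *\<^sub>R b) = r *\<^sub>R (axis i b :: complex ^ 'n)" by (simp add: vec_eq_iff axis_def)
      show "\<exists>K. \<forall>x::complex. norm (axis i x :: complex ^ 'n) \<le> norm x * K"
        by (rule exI[of _ 1]) (simp add: norm_vec_def L2_set_def axis_def if_distrib if_distribR cong: if_cong)
    qed
    from bounded_linear.has_derivative[OF this assms]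
    show "((\<lambda>q. axis i (\<phi> q $ i) :: complex ^ 'n) has_derivative (\<lambda>v. axis i (D v $ i))) (at q)" .
  qed
  moreover have "(\<Sum>i\<in>UNIV. axis i (x $ i)) = x" for x :: "complex ^ 'n"
    by (simp add: vec_eq_iff axis_def)
  ultimately show ?thesis by simp
qed

lemma has_gradient_compose:
  fixes f :: "complex ^ 'n::finite \<Rightarrow> complex" and \<phi> :: "complex ^ 'm::finite \<Rightarrow> complex ^ 'n"
  assumes "has_gradient f G (\<phi> q)" "\<And>i. has_gradient (\<lambda>q. \<phi> q $ i) (M i) q"
  shows "has_gradient (\<lambda>q. f (\<phi> q)) (\<Sum>i\<in>UNIV. G $ i *s M i) q"
proof -
  have "(\<phi> has_derivative (\<lambda>v. \<chi> i. \<Sum>j\<in>UNIV. M i $ j * v $ j)) (at q)"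
    by (rule has_derivative_vec_components) (use assms(2) in \<open>simp add: has_gradient_def\<close>)
  from has_derivative_compose[OF this assms(1)[unfolded has_gradient_def]]
  have "((\<lambda>q. f (\<phi> q)) has_derivative (\<lambda>v. \<Sum>i\<in>UNIV. G $ i * (\<Sum>j\<in>UNIV. M i $ j * v $ j))) (at q)"
    by simp
  moreover have "(\<lambda>v. \<Sum>i\<in>UNIV. G $ i * (\<Sum>j\<in>UNIV. M i $ j * v $ j)) =
     (\<lambda>v. \<Sum>j\<in>UNIV. (\<Sum>i\<in>UNIV. G $ i *s M i) $ j * v $ j)"
    by (rule ext) (simp add: sum_distrib_left sum_distrib_right mult.assoc, rule sum.swap)
  ultimately show ?thesis unfolding has_gradient_def by simp
qed

lemma has_gradient_cong:
  assumes "has_gradient f G q" "\<forall>\<^sub>F x in nhds q. f x = g x"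
  shows "has_gradient g G q"
proof -
  from assms(2) obtain S where S: "open S" "q \<in> S" "\<And>x. x \<in> S \<Longrightarrow> f x = g x"
    unfolding eventually_nhds by blast
  show ?thesis
    using has_derivative_transform_within_open[OF assms(1)[unfolded has_gradient_def] S] 
    unfolding has_gradient_def .
qed

section \<open>Partial derivatives of holomorphic functions\<close>

text \<open>
  Differentiation under the integral sign is applied to the real derivative; the integral of the
  linear forms is again complex linear because evaluation of a linear form commutes with the
  integral.
\<close>

lemma has_gradient_integral:
  fixes F :: "complex ^ 'n::finite \<Rightarrow> real \<Rightarrow> complex" and G :: "complex ^ 'n \<Rightarrow> real \<Rightarrow> complex ^ 'n"
  assumes S: "open S" "convex S" "q \<in> S"
    and grad: "\<And>q t. q \<in> S \<Longrightarrow> t \<in> {0..1} \<Longrightarrow> has_gradient (\<lambda>q. F q t) (G q t) q"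
    and F: "continuous_on (S \<times> {0..1}) (\<lambda>(q, t). F q t)"
    and G: "\<And>i. continuous_on (S \<times> {0..1}) (\<lambda>(q, t). G q t $ i)"
  shows "has_gradient (\<lambda>q. integral {0..1} (F q)) (\<chi> i. integral {0..1} (\<lambda>t. G q t $ i)) q"
proof -
  define L where "L g = Blinfun (\<lambda>v. \<Sum>i\<in>UNIV. g $ i * v $ i)" for g :: "complex ^ 'n"
  have L: "blinfun_apply (L g) = (\<lambda>v. \<Sum>i\<in>UNIV. g $ i * v $ i)" for g
    unfolding L_def by (rule bounded_linear_Blinfun_apply[OF bounded_linear_complex_linear_form])
  have "continuous_on (S \<times> {0..1}) (\<lambda>x. \<chi> i. G (fst x) (snd x) $ i)"
    using G unfolding case_prod_beta by (rule continuous_on_vec_lambda)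
  hence contG: "continuous_on (S \<times> {0..1}) (\<lambda>x. G (fst x) (snd x))" by simp
  have contL: "continuous_on (S \<times> cbox 0 1) (\<lambda>(q, t). L (G q t))"
    unfolding case_prod_beta
    by (rule continuous_on_blinfun_componentwise)
       (unfold L, intro continuous_intros, use contG in simp_all)
  have slice: "continuous_on {0..1} (\<lambda>t. H q t)" 
    if "continuous_on (S \<times> {0..1}) (\<lambda>(q, t). H q t)" "q \<in> S" for H :: "complex ^ 'n \<Rightarrow> real \<Rightarrow> complex" and q
  proof -
    have "continuous_on {0..1} (\<lambda>t. (q, t))" by (intro continuous_intros)
    from continuous_on_compose2[OF that(1) this] that(2) show ?thesis by auto
  qed
  have int: "((\<lambda>q. integral (cbox 0 1) (F q)) has_derivative integral (cbox 0 1) (\<lambda>t. L (G q t))) (at q within S)"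
  proof (rule leibniz_rule[OF _ _ contL S(3,2)])
    show "((\<lambda>q. F q t) has_derivative blinfun_apply (L (G q t))) (at q within S)"
      if "q \<in> S" "t \<in> cbox 0 1" for q t
      using grad[of q t] that unfolding has_gradient_def L by (simp add: has_derivative_at_withinI)
    show "F q integrable_on cbox 0 1" if "q \<in> S" for q
      using slice[OF F that] by (simp add: integrable_continuous_real)
  qed
  have "(\<lambda>t. L (G q t)) integrable_on cbox 0 1"
  proof (rule integrable_continuous)
    show "continuous_on (cbox 0 1) (\<lambda>t. L (G q t))"
    proof -
      have "continuous_on (cbox 0 1) (\<lambda>t::real. (q, t))" by (intro continuous_intros)
      from continuous_on_compose2[OF contL this] S(3) show ?thesis by auto
    qed
  qed
  hence "blinfun_apply (integral (cbox 0 1) (\<lambda>t. L (G q t))) v =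
     (\<Sum>i\<in>UNIV. (\<chi> i. integral {0..1} (\<lambda>t. G q t $ i)) $ i * v $ i)" for v
  proof -
    have "blinfun_apply (integral (cbox 0 1) (\<lambda>t. L (G q t))) v = integral (cbox 0 1) (\<lambda>t. L (G q t) v)"
      by (rule blinfun_apply_integral) fact
    also have "\<dots> = (\<Sum>i\<in>UNIV. integral {0..1} (\<lambda>t. G q t $ i * v $ i))"
      unfolding L by (subst integral_sum)
       (use slice[OF G S(3)] in \<open>auto intro!: integrable_continuous_real continuous_on_mult_right\<close>)
    finally show ?thesis by simp
  qed
  hence "blinfun_apply (integral (cbox 0 1) (\<lambda>t. L (G q t))) =
     (\<lambda>v. \<Sum>i\<in>UNIV. (\<chi> i. integral {0..1} (\<lambda>t. G q t $ i)) $ i * v $ i)" by blast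
  with int show ?thesis
    unfolding has_gradient_def using at_within_open[OF S(3,1)] by simp
qed


lemma norm_scale_axis: "norm (s *s (axis i 1 :: complex ^ 'n::finite)) = norm s"
  by (simp add: norm_vec_def L2_set_def axis_def if_distrib if_distribR cong: if_cong)

lemma dist_axis_shift:
  fixes q :: "complex ^ 'n::finite"
  shows "dist q0 (q + s *s axis i 1) \<le> dist q0 q + norm s"
proof -
  have "dist q0 (q + s *s axis i 1) \<le> dist q0 q + dist q (q + s *s axis i 1)" by (rule dist_triangle)
  thus ?thesis by (simp add: dist_norm norm_scale_axis)
qed

text \<open>
  Cauchy's formula in one coordinate direction. It expresses a partial derivative through the values
  of \<open>f\<close>, so that regularity of \<open>f\<close> passes to its partial derivatives.
\<close>

lemma pd_eq_Cauchy_integral: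
  assumes f: "hol_on (ball q0 r) f" and \<rho>: "\<rho> > 0" "dist q0 q + \<rho> < r"
  shows "pd i f q = integral {0..1}
    (\<lambda>t. f (q + (of_real \<rho> * exp (2 * of_real pi * \<i> * of_real t)) *s axis i 1) /
         (of_real \<rho> * exp (2 * of_real pi * \<i> * of_real t)))"
proof -
  define g where "g s = f (q + s *s axis i 1)" for s
  have inb: "q + s *s axis i 1 \<in> ball q0 r" if "s \<in> cball 0 \<rho>" for s
    using dist_axis_shift[of q0 q s i] that \<rho>(2) by simp
  have g: "g holomorphic_on cball 0 \<rho>"
    unfolding g_def by (rule hol_on_imp_holomorphic_line[OF f inb])
  have D: "(g has_field_derivative (1 / (2 * of_real pi * \<i>) *
        contour_integral (circlepath 0 \<rho>) (\<lambda>u. g u / (u - 0)\<^sup>2))) (at 0)"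
    by (rule Cauchy_derivative_integral_circlepath)
      (use g \<rho>(1) in \<open>auto intro!: holomorphic_on_imp_continuous_on intro: holomorphic_on_subset\<close>)
  have "pd i f q = 1 / (2 * of_real pi * \<i>) * contour_integral (circlepath 0 \<rho>) (\<lambda>u. g u / u\<^sup>2)"
    using DERIV_imp_deriv[OF D] by (simp add: pd_def g_def[abs_def])
  also have "contour_integral (circlepath 0 \<rho>) (\<lambda>u. g u / u\<^sup>2) =
     integral {0..1} (\<lambda>t. (2 * of_real pi * \<i>) * (g (of_real \<rho> * exp (2 * of_real pi * \<i> * of_real t)) /
         (of_real \<rho> * exp (2 * of_real pi * \<i> * of_real t))))"
    unfolding contour_integral_integral vector_derivative_circlepath
    by (rule integral_cong) (use \<rho> in \<open>simp add: circlepath power2_eq_square field_simps\<close>)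
  also have "\<dots> = (2 * of_real pi * \<i>) * integral {0..1}
     (\<lambda>t. g (of_real \<rho> * exp (2 * of_real pi * \<i> * of_real t)) /
         (of_real \<rho> * exp (2 * of_real pi * \<i> * of_real t)))"
    by (rule integral_mult_right)
  finally show ?thesis by (simp add: g_def)
qed


lemma continuous_on_circle_shift:
  fixes g :: "complex ^ 'a::finite \<Rightarrow> complex"
  assumes "continuous_on (ball q0 r) g" "\<rho> > 0" "R + \<rho> \<le> r"
  shows "continuous_on (ball q0 R \<times> {0..1})
    (\<lambda>(q, t). g (q + (of_real \<rho> * exp (2 * of_real pi * \<i> * of_real t)) *s axis i 1) /
         (of_real \<rho> * exp (2 * of_real pi * \<i> * of_real t)))"
proof -
  have bl: "continuous_on UNIV (\<lambda>s::complex. s *s (axis i 1 :: complex ^ 'a))"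
  proof -
    have "(\<lambda>s::complex. s *s (axis i 1 :: complex ^ 'a)) = (\<lambda>s. \<chi> j. s * axis i 1 $ j)"
      by (simp add: vec_eq_iff fun_eq_iff)
    moreover have "continuous_on UNIV (\<lambda>s::complex. \<chi> j. s * (axis i 1 :: complex ^ 'a) $ j)"
      by (intro continuous_on_vec_lambda continuous_intros)
    ultimately show ?thesis by (rule ssubst[where P = "continuous_on UNIV"])
  qed
  have "continuous_on (ball q0 R \<times> {0..1})
     (\<lambda>x. g (fst x + (of_real \<rho> * exp (2 * of_real pi * \<i> * of_real (snd x))) *s axis i 1))"
  proof (rule continuous_on_compose2[OF assms(1)])
    show "continuous_on (ball q0 R \<times> {0..1})
     (\<lambda>x. fst x + (of_real \<rho> * exp (2 * of_real pi * \<i> * of_real (snd x))) *s axis i 1)"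
      by (intro continuous_intros continuous_on_compose2[OF bl]) auto
    show "(\<lambda>x. fst x + (of_real \<rho> * exp (2 * of_real pi * \<i> * of_real (snd x))) *s axis i 1) `
          (ball q0 R \<times> {0..1}) \<subseteq> ball q0 r"
    proof clarsimp
      fix q and t :: real assume "dist q0 q < R"
      moreover have "dist q0 (q + (of_real \<rho> * exp (2 * of_real pi * \<i> * of_real t)) *s axis i 1)
          \<le> dist q0 q + \<rho>"
        using dist_axis_shift[of q0 q "of_real \<rho> * exp (2 * of_real pi * \<i> * of_real t)" i] assms(2)
        by (simp add: norm_mult)
      ultimately show "dist q0 (q + (of_real \<rho> * exp (2 * of_real pi * \<i> * of_real t)) *s axis i 1) < r"
        using assms(3) by linarith
    qed
  qed
  thus ?thesis unfolding case_prod_beta using assms(2)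
    by (intro continuous_intros) auto
qed

text \<open>
  Continuity of the partial derivatives has to come before their differentiability: differentiating
  Cauchy's integral with respect to the base point needs a continuous integrand.
\<close>

lemma continuous_on_pd:
  fixes f :: "complex ^ 'n::finite \<Rightarrow> complex"
  assumes "open S" "hol_on S f"
  shows "continuous_on S (pd i f)"
proof (rule continuous_at_imp_continuous_on, rule ballI)
  fix q0 assume "q0 \<in> S"
  then obtain r where r: "r > 0" "ball q0 r \<subseteq> S" using assms(1) openE by blast
  have f: "hol_on (ball q0 r) f" using assms(2) r(2) hol_on_subset by blast
  have "continuous_on (ball q0 (r/2) \<times> {0..1})
    (\<lambda>(q, t). f (q + (of_real (r/4) * exp (2 * of_real pi * \<i> * of_real t)) *s axis i 1) /
         (of_real (r/4) * exp (2 * of_real pi * \<i> * of_real t)))"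
    by (rule continuous_on_circle_shift[OF hol_on_imp_continuous_on[OF f]]) (use r in auto)
  hence "continuous_on (ball q0 (r/2)) (\<lambda>q. integral {0..1}
    (\<lambda>t. f (q + (of_real (r/4) * exp (2 * of_real pi * \<i> * of_real t)) *s axis i 1) /
         (of_real (r/4) * exp (2 * of_real pi * \<i> * of_real t))))"
    by (rule integral_continuous_on_param[of "ball q0 (r/2)" "0::real" 1, unfolded box_real])
  moreover have "pd i f q = integral {0..1}
    (\<lambda>t. f (q + (of_real (r/4) * exp (2 * of_real pi * \<i> * of_real t)) *s axis i 1) /
         (of_real (r/4) * exp (2 * of_real pi * \<i> * of_real t)))" if "q \<in> ball q0 (r/2)" for q
    by (rule pd_eq_Cauchy_integral[OF f]) (use r that in auto)
  ultimately have "continuous_on (ball q0 (r/2)) (pd i f)"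
    using continuous_on_cong by (metis (no_types, lifting))
  thus "isCont (pd i f) q0"
    using r(1) by (simp add: continuous_on_eq_continuous_at)
qed

text \<open>
  Differentiating Cauchy's integral for \<open>pd i f\<close> in direction \<open>j\<close> replaces \<open>f\<close> by \<open>pd j f\<close> under
  the integral. Reading the result once more as a Cauchy integral, now of \<open>pd j f\<close> in direction
  \<open>i\<close>, gives the symmetry of the mixed second derivatives at no extra cost.
\<close>

lemma has_gradient_pd_integral:
  fixes f :: "complex ^ 'n::finite \<Rightarrow> complex"
  assumes f: "hol_on (ball q0 r) f" and r: "r > 0"
  shows "has_gradient (pd i f) (\<chi> j. integral {0..1}
    (\<lambda>t. pd j f (q0 + (of_real (r/4) * exp (2 * of_real pi * \<i> * of_real t)) *s axis i 1) /
         (of_real (r/4) * exp (2 * of_real pi * \<i> * of_real t)))) q0"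
proof -
  let ?c = "\<lambda>t::real. of_real (r/4) * exp (2 * of_real pi * \<i> * of_real t) :: complex"
  have comp: "(inverse c *s differential f p) $ j = pd j f p / c" for c p j
    by (simp add: differential_def divide_inverse mult.commute)
  have "has_gradient (\<lambda>q. integral {0..1} (\<lambda>t. f (q + ?c t *s axis i 1) / ?c t))
     (\<chi> j. integral {0..1} (\<lambda>t. (inverse (?c t) *s differential f (q0 + ?c t *s axis i 1)) $ j)) q0"
  proof (rule has_gradient_integral[of "ball q0 (r/2)"])
    fix q and t :: real assume q: "q \<in> ball q0 (r/2)"
    let ?p = "q + ?c t *s axis i 1"
    have p: "?p \<in> ball q0 r"
      using dist_axis_shift[of q0 q "?c t" i] q r by (simp add: norm_mult)
    have 1: "has_gradient (\<lambda>q. (q + ?c t *s axis i 1) $ j) (axis j 1) q" for j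
      using has_gradient_add[OF has_gradient_coordinate has_gradient_const] by simp
    have 2: "has_gradient (\<lambda>q. f (q + ?c t *s axis i 1)) (differential f ?p) q"
      using has_gradient_compose[OF hol_onD[OF f p] 1] by (simp add: basis_expansion)
    have "((\<lambda>z. z / ?c t) has_field_derivative inverse (?c t)) (at z)" for z
      using r by (auto intro!: derivative_eq_intros simp: field_simps)
    from has_gradient_field_compose[OF 2 this]
    show "has_gradient (\<lambda>q. f (q + ?c t *s axis i 1) / ?c t) (inverse (?c t) *s differential f ?p) q" .
  next
    show "continuous_on (ball q0 (r/2) \<times> {0..1}) (\<lambda>(q, t). f (q + ?c t *s axis i 1) / ?c t)"
      by (rule continuous_on_circle_shift[OF hol_on_imp_continuous_on[OF f]]) (use r in auto)
    fix j
    show "continuous_on (ball q0 (r/2) \<times> {0..1})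
        (\<lambda>(q, t). (inverse (?c t) *s differential f (q + ?c t *s axis i 1)) $ j)"
      unfolding comp by (rule continuous_on_circle_shift[OF continuous_on_pd[OF open_ball f]]) (use r in auto)
  qed (use r in auto)
  hence "has_gradient (\<lambda>q. integral {0..1} (\<lambda>t. f (q + ?c t *s axis i 1) / ?c t))
     (\<chi> j. integral {0..1} (\<lambda>t. pd j f (q0 + ?c t *s axis i 1) / ?c t)) q0"
    unfolding comp .
  moreover have "\<forall>\<^sub>F q in nhds q0. integral {0..1} (\<lambda>t. f (q + ?c t *s axis i 1) / ?c t) = pd i f q"
    unfolding eventually_nhds
  proof (intro exI[of _ "ball q0 (r/2)"] conjI ballI)
    fix q assume "q \<in> ball q0 (r/2)"
    hence "dist q0 q + r/4 < r" using r by simp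
    thus "integral {0..1} (\<lambda>t. f (q + ?c t *s axis i 1) / ?c t) = pd i f q"
      by (intro pd_eq_Cauchy_integral[OF f, symmetric]) (use r in simp_all)
  qed (use r in simp_all)
  ultimately show ?thesis by (rule has_gradient_cong)
qed

lemma hol_on_pd:
  fixes f :: "complex ^ 'n::finite \<Rightarrow> complex"
  assumes "open S" "hol_on S f"
  shows "hol_on S (pd i f)"
  unfolding hol_on_def
proof
  fix q assume "q \<in> S"
  then obtain r where "r > 0" "ball q r \<subseteq> S" using assms(1) openE by blast
  thus "\<exists>G. has_gradient (pd i f) G q"
    using has_gradient_pd_integral assms(2) hol_on_subset by blast
qed

lemma pd_commute:
  fixes f :: "complex ^ 'n::finite \<Rightarrow> complex"
  assumes "open S" "hol_on S f" "q \<in> S"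
  shows "pd i (pd j f) q = pd j (pd i f) q"
proof -
  obtain r where r: "r > 0" "ball q r \<subseteq> S" using assms openE by blast
  have f: "hol_on (ball q r) f" using assms(2) r(2) hol_on_subset by blast
  show ?thesis
    using pd_eq_Cauchy_integral[OF hol_on_pd[OF open_ball f], of "r/4" q i j] r(1)
      has_gradient_imp_pd[OF has_gradient_pd_integral[OF f r(1), of i], of j] by simp
qed

section \<open>Holomorphic functions on a bidisc\<close>

definition polydisc :: "real \<Rightarrow> (complex ^ 2) set" where
  "polydisc r = {q. norm (q $ 1) < r \<and> norm (q $ 2) < r}"

lemma mem_polydisc_vector [simp]: "vector [x, y] \<in> polydisc r \<longleftrightarrow> norm x < r \<and> norm y < r"
  by (simp add: polydisc_def)

lemma vector_2_coordinates: "vector [q $ 1, q $ 2] = (q :: complex ^ 2)"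
  by (simp add: vec_eq_iff forall_2)

lemma open_polydisc: "open (polydisc r)"
  unfolding polydisc_def by (intro open_Collect_conj open_Collect_less continuous_intros)

lemma convex_polydisc: "convex (polydisc r)"
proof -
  have "polydisc r = (\<lambda>q. q $ 1) -` ball 0 r \<inter> (\<lambda>q. q $ 2) -` ball 0 r"
    by (auto simp: polydisc_def)
  thus ?thesis
    by (auto intro!: convex_Int convex_linear_vimage bounded_linear.linear bounded_linear_vec_nth)
qed

lemma eventually_nhds_0_polydisc:
  "(\<forall>\<^sub>F q in nhds 0. P q) \<longleftrightarrow> (\<exists>r>0. \<forall>q\<in>polydisc r. P q)"
proof
  assume "\<forall>\<^sub>F q in nhds 0. P q"
  then obtain d where d: "d > 0" "\<And>q. norm q < d \<Longrightarrow> P q"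
    unfolding eventually_nhds_metric by auto
  have "norm q < d" if "q \<in> polydisc (d/2)" for q
  proof -
    have "norm q \<le> (\<Sum>i\<in>UNIV. norm (q $ i))" unfolding norm_vec_def by (rule L2_set_le_sum) simp
    thus ?thesis using that by (simp add: sum_2 polydisc_def)
  qed
  thus "\<exists>r>0. \<forall>q\<in>polydisc r. P q" using d by (intro exI[of _ "d/2"]) auto
next
  assume "\<exists>r>0. \<forall>q\<in>polydisc r. P q"
  then obtain r where "r > 0" "\<forall>q\<in>polydisc r. P q" by blast
  thus "\<forall>\<^sub>F q in nhds 0. P q"
    unfolding eventually_nhds by (intro exI[of _ "polydisc r"]) (simp add: open_polydisc, simp add: polydisc_def)
qed

lemma slice2_has_field_derivative:
  fixes f :: "complex ^ 2 \<Rightarrow> complex"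
  assumes "has_gradient f G (vector [x, y])"
  shows "((\<lambda>y. f (vector [x, y])) has_field_derivative pd 2 f (vector [x, y])) (at y)"
proof -
  have eq: "vector [x, y] = vector [x, 0] + y *s (axis 2 1 :: complex ^ 2)" for y :: complex
    by (simp add: vec_eq_iff forall_2 axis_def)
  have "(\<Sum>i\<in>UNIV. G $ i * (axis 2 1 :: complex ^ 2) $ i) = pd 2 f (vector [x, y])"
    using has_gradient_imp_pd[OF assms, of 2] by (simp add: sum_2 axis_def)
  thus ?thesis using has_gradient_imp_line_at[OF assms[unfolded eq[of y]]] by (simp add: eq[symmetric])
qed

lemma slice1_has_field_derivative:
  fixes f :: "complex ^ 2 \<Rightarrow> complex"
  assumes "has_gradient f G (vector [x, y])"
  shows "((\<lambda>x. f (vector [x, y])) has_field_derivative pd 1 f (vector [x, y])) (at x)"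
proof -
  have eq: "vector [x, y] = vector [0, y] + x *s (axis 1 1 :: complex ^ 2)" for x :: complex
    by (simp add: vec_eq_iff forall_2 axis_def)
  have "(\<Sum>i\<in>UNIV. G $ i * (axis 1 1 :: complex ^ 2) $ i) = pd 1 f (vector [x, y])"
    using has_gradient_imp_pd[OF assms, of 1] by (simp add: sum_2 axis_def)
  thus ?thesis using has_gradient_imp_line_at[OF assms[unfolded eq[of x]]] by (simp add: eq[symmetric])
qed

lemma slice_holomorphic:
  assumes "hol_on (polydisc r) f"
  shows "norm x < r \<Longrightarrow> (\<lambda>y. f (vector [x, y])) holomorphic_on ball 0 r"
    and "norm y < r \<Longrightarrow> (\<lambda>x. f (vector [x, y])) holomorphic_on ball 0 r"
  by (auto simp: holomorphic_on_open intro!: exI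
      intro: slice1_has_field_derivative[OF hol_onD[OF assms]] slice2_has_field_derivative[OF hol_onD[OF assms]])

text \<open>
  The quotient \<open>g / y\<close> is the integral of \<open>\<partial>g/\<partial>y (x, t y)\<close> over \<open>0 \<le> t \<le> 1\<close>, an expression that is
  holomorphic across the axis \<open>y = 0\<close>.
\<close>

lemma divide_by_second_coordinate:
  assumes g: "hol_on (polydisc r) g" and zero: "\<And>x. norm x < r \<Longrightarrow> g (vector [x, 0]) = 0"
  obtains g1 where "hol_on (polydisc r) g1" "\<And>q. q \<in> polydisc r \<Longrightarrow> g q = q $ 2 * g1 q"
proof
  define \<tau> :: "complex ^ 2 \<Rightarrow> real \<Rightarrow> complex ^ 2" where "\<tau> q t = vector [q $ 1, of_real t * q $ 2]" for q t
  define F where "F q t = pd 2 g (\<tau> q t)" for q t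
  define G where "G q t = pd 1 (pd 2 g) (\<tau> q t) *s axis 1 1 + (pd 2 (pd 2 g) (\<tau> q t) * of_real t) *s (axis 2 1 :: complex ^ 2)"
    for q t
  have g2: "hol_on (polydisc r) (pd 2 g)" by (rule hol_on_pd[OF open_polydisc g])
  have \<tau>: "\<tau> q t \<in> polydisc r" if "q \<in> polydisc r" "t \<in> {0..1}" for q t
  proof -
    have "\<bar>t\<bar> * norm (q $ 2) \<le> norm (q $ 2)" using that(2) by (intro mult_left_le_one_le) auto
    thus ?thesis using that(1) by (simp add: \<tau>_def polydisc_def norm_mult)
  qed
  have cont\<tau>: "continuous_on (polydisc r \<times> {0..1}) (\<lambda>x. \<tau> (fst x) (snd x))"
  proof -
    have "\<tau> (fst x) (snd x) = (\<chi> i. if i = 1 then fst x $ 1 else of_real (snd x) * fst x $ 2)" for x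
      by (simp add: \<tau>_def vec_eq_iff forall_2)
    moreover have "continuous_on (polydisc r \<times> {0..1})
        (\<lambda>x. if i = 1 then fst x $ 1 else of_real (snd x) * fst x $ 2)" for i :: 2
      by (cases "i = 1") (auto intro!: continuous_intros)
    ultimately show ?thesis by (simp add: continuous_on_vec_lambda)
  qed
  have cont: "continuous_on (polydisc r \<times> {0..1}) (\<lambda>x. H (\<tau> (fst x) (snd x)))"
    if "hol_on (polydisc r) H" for H
    by (rule continuous_on_compose2[OF hol_on_imp_continuous_on[OF that] cont\<tau>]) (use \<tau> in auto)
  have grad: "has_gradient (\<lambda>q. F q t) (G q t) q" if "q \<in> polydisc r" "t \<in> {0..1}" for q t
  proof -
    have "has_gradient (\<lambda>q. \<tau> q t $ i) (if i = 1 then axis 1 1 else of_real t *s axis 2 1) q" for i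
      using exhaust_2[of i] has_gradient_coordinate[of 1 q]
        has_gradient_mult[OF has_gradient_const[of "of_real t"] has_gradient_coordinate[of 2 q]]
      by (auto simp: \<tau>_def)
    from has_gradient_compose[OF hol_onD[OF g2 \<tau>[OF that]] this]
    show ?thesis by (simp add: F_def G_def sum_2 differential_def)
  qed
  have "has_gradient (\<lambda>q. integral {0..1} (F q)) (\<chi> i. integral {0..1} (\<lambda>t. G q t $ i)) q"
    if "q \<in> polydisc r" for q
  proof (rule has_gradient_integral[OF open_polydisc convex_polydisc that grad])
    show "continuous_on (polydisc r \<times> {0..1}) (\<lambda>(q, t). F q t)"
      using cont[OF g2] by (simp add: F_def case_prod_beta)
    show "continuous_on (polydisc r \<times> {0..1}) (\<lambda>(q, t). G q t $ i)" for i
      using cont[OF hol_on_pd[OF open_polydisc g2]]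
      by (auto simp: G_def case_prod_beta intro!: continuous_intros)
  qed
  thus "hol_on (polydisc r) (\<lambda>q. integral {0..1} (F q))" by (rule hol_onI)
  fix q assume q: "q \<in> polydisc r"
  have "((\<lambda>t. q $ 2 * F q t) has_integral g (\<tau> q 1) - g (\<tau> q 0)) {0..1}"
  proof (rule fundamental_theorem_of_calculus)
    fix t :: real assume t: "t \<in> {0..1}"
    have "((\<lambda>y. g (vector [q $ 1, y])) has_field_derivative F q t) (at (of_real t * q $ 2))"
      using slice2_has_field_derivative[OF hol_onD[OF g \<tau>[OF q t], unfolded \<tau>_def]]
      by (simp add: F_def \<tau>_def)
    moreover have "((\<lambda>t. of_real t * q $ 2) has_vector_derivative q $ 2) (at t within {0..1})"
      by (auto intro!: derivative_eq_intros)
    ultimately show "((\<lambda>t. g (\<tau> q t)) has_vector_derivative q $ 2 * F q t) (at t within {0..1})"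
      using field_vector_diff_chain_within[of "\<lambda>t. of_real t * q $ 2" "q $ 2" t "{0..1}" "\<lambda>y. g (vector [q $ 1, y])"]
      by (auto simp: \<tau>_def o_def intro: has_field_derivative_at_within)
  qed simp
  moreover have "g (\<tau> q 0) = 0" using zero q by (simp add: \<tau>_def polydisc_def)
  moreover have "\<tau> q 1 = q" by (simp add: \<tau>_def vector_2_coordinates)
  ultimately have "((\<lambda>t. q $ 2 * F q t) has_integral g q) {0..1}" by simp
  from integral_unique[OF this] show "g q = q $ 2 * integral {0..1} (F q)" by simp
qed

lemma zero_if_continuous_and_zero_off_point:
  fixes k :: "complex \<Rightarrow> complex"
  assumes "isCont k a" "\<forall>\<^sub>F y in at a. k y = 0"
  shows "k a = 0"
proof -
  have "(k \<longlongrightarrow> k a) (at a)" using assms(1) by (simp add: isCont_def)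
  moreover have "(k \<longlongrightarrow> 0) (at a)" using assms(2) by (rule tendsto_eventually)
  ultimately show ?thesis using tendsto_unique[OF at_neq_bot] by blast
qed

lemma infinite_order_zero_imp_zero:
  assumes k: "k holomorphic_on ball 0 r" and r: "r > 0"
    and div: "\<And>m. \<exists>u. continuous_on (ball 0 r) u \<and> (\<forall>y\<in>ball 0 r. k y = y ^ m * u y)"
    and y: "y \<in> ball 0 r"
  shows "k y = 0"
proof (rule ccontr)
  assume "k y \<noteq> 0"
  have "k 0 = 0" using div[of 1] r by auto
  hence nc: "\<not> k constant_on ball 0 r" using \<open>k y \<noteq> 0\<close> y r unfolding constant_on_def by force
  have "0 \<in> ball 0 r" using r by simp
  note factor = holomorphic_factor_zero_nonconstant[OF k open_ball connected_ball this \<open>k 0 = 0\<close> nc]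
  obtain g s n where g: "0 < n" "0 < s" "ball (0::complex) s \<subseteq> ball 0 r" "g holomorphic_on ball 0 s"
    "\<forall>w\<in>ball 0 s. k w = w ^ n * g w" "\<forall>w\<in>ball 0 s. g w \<noteq> 0"
  proof (rule factor)
    fix g s n
    assume a: "0 < n" "0 < s" "ball (0::complex) s \<subseteq> ball 0 r" "g holomorphic_on ball 0 s"
      "\<And>w. w \<in> ball 0 s \<Longrightarrow> k w = (w - 0) ^ n * g w" "\<And>w. w \<in> ball 0 s \<Longrightarrow> g w \<noteq> 0"
    have "\<forall>w\<in>ball 0 s. k w = w ^ n * g w" "\<forall>w\<in>ball 0 s. g w \<noteq> 0" using a(5,6) by simp_all
    thus thesis by (rule that[OF a(1-4)])
  qed
  obtain u where u: "continuous_on (ball 0 r) u" "\<forall>y\<in>ball 0 r. k y = y ^ Suc n * u y"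
    using div[of "Suc n"] by (elim exE conjE) (rule that; assumption)
  have "isCont (\<lambda>w. g w - w * u w) 0"
    using holomorphic_on_imp_continuous_on[OF g(4)] u(1) g(2) r
    by (auto simp: continuous_on_eq_continuous_at intro!: continuous_intros)
  moreover have "\<forall>\<^sub>F w in at 0. g w - w * u w = 0"
    unfolding eventually_at
  proof (intro exI[of _ s] conjI ballI impI)
    fix w :: complex assume "w \<noteq> 0 \<and> dist w 0 < s"
    hence w: "w \<noteq> 0" "w \<in> ball 0 s" by (simp_all add: dist_commute)
    have "w ^ n * g w = w ^ n * (w * u w)" using bspec[OF g(5) w(2)] bspec[OF u(2) subsetD[OF g(3) w(2)]] by auto
    thus "g w - w * u w = 0" using w(1) by simp
  qed (use g in auto)
  ultimately have "g 0 - 0 * u 0 = 0" by (rule zero_if_continuous_and_zero_off_point)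
  thus False using g(2) bspec[OF g(6), of 0] by simp
qed

text \<open>
  If division by \<open>y\<close> could be repeated forever, every slice \<open>y \<mapsto> g (x, y)\<close> would vanish to infinite
  order at \<open>0\<close> and \<open>g\<close> would be zero. It is essential here that the division does not shrink the
  polydisc.
\<close>

lemma factor_second_coordinate:
  assumes g: "hol_on (polydisc r) g" and nz: "q0 \<in> polydisc r" "g q0 \<noteq> 0"
  obtains m v x where "hol_on (polydisc r) v" "\<And>q. q \<in> polydisc r \<Longrightarrow> g q = (q $ 2) ^ m * v q"
    "norm x < r" "v (vector [x, 0]) \<noteq> 0"
proof (rule ccontr)
  note ex_factor = that
  assume "\<not> thesis"
  hence step: "v (vector [x, 0]) = 0" if "hol_on (polydisc r) v" "\<forall>q\<in>polydisc r. g q = (q $ 2) ^ m * v q"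
    "norm x < r" for m v x
    using ex_factor[OF that(1) _ that(3)] that(2) \<open>\<not> thesis\<close> by blast
  have ex: "\<exists>v. hol_on (polydisc r) v \<and> (\<forall>q\<in>polydisc r. g q = (q $ 2) ^ m * v q)" for m
  proof (induction m)
    case 0
    show ?case using g by auto
  next
    case (Suc m)
    then obtain v where v: "hol_on (polydisc r) v" "\<forall>q\<in>polydisc r. g q = (q $ 2) ^ m * v q" by blast
    obtain v1 where v1: "hol_on (polydisc r) v1" "\<And>q. q \<in> polydisc r \<Longrightarrow> v q = q $ 2 * v1 q"
      using divide_by_second_coordinate[OF v(1) step[OF v]] by blast
    thus ?case using v by (intro exI[of _ v1]) auto
  qed
  have x: "norm (q0 $ 1) < r" "norm (q0 $ 2) < r" using nz(1) by (auto simp: polydisc_def)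
  have "g (vector [q0 $ 1, q0 $ 2]) = 0"
  proof (rule infinite_order_zero_imp_zero[where k = "\<lambda>y. g (vector [q0 $ 1, y])" and r = r])
    show "(\<lambda>y. g (vector [q0 $ 1, y])) holomorphic_on ball 0 r" using slice_holomorphic(1)[OF g x(1)] .
    show "r > 0" using x(1) norm_ge_zero le_less_trans by blast
    fix m
    obtain v where v: "hol_on (polydisc r) v" "\<forall>q\<in>polydisc r. g q = (q $ 2) ^ m * v q" using ex by blast
    show "\<exists>u. continuous_on (ball 0 r) u \<and> (\<forall>y\<in>ball 0 r. g (vector [q0 $ 1, y]) = y ^ m * u y)"
      using holomorphic_on_imp_continuous_on[OF slice_holomorphic(1)[OF v(1) x(1)]] v(2) x(1)
      by (intro exI[of _ "\<lambda>y. v (vector [q0 $ 1, y])"]) auto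
  qed (use x in auto)
  thus False using nz(2) by (simp add: vector_2_coordinates)
qed

lemma holomorphic_product_zero:
  assumes "f holomorphic_on ball 0 r" "g holomorphic_on ball 0 r"
    and "\<And>x. x \<in> ball 0 r \<Longrightarrow> f x * g x = 0" and x1: "x1 \<in> ball 0 r" "g x1 \<noteq> 0"
    and x: "x \<in> ball 0 r"
  shows "f x = 0"
proof -
  have "isCont g x1"
    using holomorphic_on_imp_continuous_on[OF assms(2)] x1(1) by (simp add: continuous_on_eq_continuous_at)
  then obtain e where e: "e > 0" "\<And>y. dist x1 y < e \<Longrightarrow> g y \<noteq> 0"
    using continuous_at_avoid[of x1 g 0] x1(2) by auto
  show ?thesis
  proof (rule analytic_continuation_open[of "ball x1 e \<inter> ball 0 r" "ball 0 r" f "\<lambda>_. 0"])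
    show "ball x1 e \<inter> ball 0 r \<noteq> {}" using e(1) x1(1) by (metis IntI centre_in_ball empty_iff)
    fix z assume "z \<in> ball x1 e \<inter> ball 0 r"
    thus "f z = 0" using e(2)[of z] assms(3)[of z] by auto
  qed (use assms x in auto)
qed

section \<open>Maps that pull the form back to a multiple of dx\<close>

text \<open>
  Suppose that the pull-back of \<open>B(t) dt + (2 z + A(t)) dz\<close> by \<open>(T, Z)\<close> equals \<open>h dx\<close>. The exterior
  derivative of the form is \<open>A'(t) dt \<and> dz\<close>, so comparing the exterior derivatives of both sides gives
  the first identity; the second one follows by eliminating the first derivatives of \<open>T\<close> with the
  help of the two given equations.
\<close>

lemma pd_2_of_dx_coefficient:
  assumes T: "hol_on (polydisc r) T" and Z: "hol_on (polydisc r) Z"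
    and A: "\<And>q. q \<in> polydisc r \<Longrightarrow> (A has_field_derivative A' (T q)) (at (T q))"
    and B: "\<And>q. q \<in> polydisc r \<Longrightarrow> (B has_field_derivative B' (T q)) (at (T q))"
    and eq1: "\<And>q. q \<in> polydisc r \<Longrightarrow> B (T q) * pd 1 T q + (2 * Z q + A (T q)) * pd 1 Z q = h q"
    and eq2: "\<And>q. q \<in> polydisc r \<Longrightarrow> B (T q) * pd 2 T q + (2 * Z q + A (T q)) * pd 2 Z q = 0"
    and q: "q \<in> polydisc r"
  shows "pd 2 h q = A' (T q) * (pd 2 T q * pd 1 Z q - pd 1 T q * pd 2 Z q)"
    and "B (T q) * pd 2 h q = - A' (T q) * pd 2 Z q * h q"
proof -
  have ev: "\<forall>\<^sub>F x in nhds q. x \<in> polydisc r"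
    using eventually_nhds open_polydisc q by blast
  have row: "\<exists>G. has_gradient g G q \<and> G $ j =
      B (T q) * pd j (pd i T) q + pd i T q * (B' (T q) * pd j T q) +
      ((2 * Z q + A (T q)) * pd j (pd i Z) q + pd i Z q * (2 * pd j Z q + A' (T q) * pd j T q))"
    if "\<And>x. x \<in> polydisc r \<Longrightarrow> B (T x) * pd i T x + (2 * Z x + A (T x)) * pd i Z x = g x" for i j g
  proof -
    note gr = hol_onD[OF T q] hol_onD[OF Z q] hol_onD[OF hol_on_pd[OF open_polydisc T] q, of i]
      hol_onD[OF hol_on_pd[OF open_polydisc Z] q, of i]
    note C = has_gradient_add[OF has_gradient_mult[OF has_gradient_const[of 2] gr(2)]
        has_gradient_field_compose[OF gr(1) A[OF q]]]
    note S = has_gradient_add[OF has_gradient_mult[OF has_gradient_field_compose[OF gr(1) B[OF q]] gr(3)]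
        has_gradient_mult[OF C gr(4)]]
    have "\<forall>\<^sub>F x in nhds q. B (T x) * pd i T x + (2 * Z x + A (T x)) * pd i Z x = g x"
      by (rule eventually_mono[OF ev]) (rule that)
    from has_gradient_cong[OF S this] show ?thesis
      by (intro exI conjI) (assumption, simp add: differential_def algebra_simps)
  qed
  have ZT: "pd 2 (pd 1 T) q = pd 1 (pd 2 T) q" "pd 2 (pd 1 Z) q = pd 1 (pd 2 Z) q"
    using pd_commute[OF open_polydisc _ q] T Z by blast+
  obtain G where G: "has_gradient h G q" "G $ 2 =
      B (T q) * pd 2 (pd 1 T) q + pd 1 T q * (B' (T q) * pd 2 T q) +
      ((2 * Z q + A (T q)) * pd 2 (pd 1 Z) q + pd 1 Z q * (2 * pd 2 Z q + A' (T q) * pd 2 T q))"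
    using row[OF eq1] by blast
  obtain G0 where G0: "has_gradient (\<lambda>_. 0) G0 q" "G0 $ 1 =
      B (T q) * pd 1 (pd 2 T) q + pd 2 T q * (B' (T q) * pd 1 T q) +
      ((2 * Z q + A (T q)) * pd 1 (pd 2 Z) q + pd 2 Z q * (2 * pd 1 Z q + A' (T q) * pd 1 T q))"
    using row[of 2 "\<lambda>_. 0" 1, OF eq2] by blast
  have "G0 $ 1 = 0"
    using has_gradient_imp_pd[OF G0(1)] has_gradient_imp_pd[OF has_gradient_const] by (metis zero_index)
  hence "G $ 2 = A' (T q) * (pd 2 T q * pd 1 Z q - pd 1 T q * pd 2 Z q)"
    using G(2) G0(2) ZT by (simp add: algebra_simps)
  thus h2: "pd 2 h q = A' (T q) * (pd 2 T q * pd 1 Z q - pd 1 T q * pd 2 Z q)"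
    using has_gradient_imp_pd[OF G(1)] by simp
  have "B (T q) * pd 2 h q = A' (T q) * ((B (T q) * pd 2 T q) * pd 1 Z q - (B (T q) * pd 1 T q) * pd 2 Z q)"
    unfolding h2 by (simp add: algebra_simps)
  also have "B (T q) * pd 2 T q = - ((2 * Z q + A (T q)) * pd 2 Z q)"
    using eq2[OF q] by (simp add: eq_neg_iff_add_eq_0)
  also have "B (T q) * pd 1 T q = h q - (2 * Z q + A (T q)) * pd 1 Z q"
    using eq1[OF q] by (simp add: algebra_simps)
  finally show "B (T q) * pd 2 h q = - A' (T q) * pd 2 Z q * h q"
    by (simp add: algebra_simps)
qed

text \<open>
  Put \<open>h = y\<^sup>n w\<close> into \<open>B(T) h\<^sub>y = - A'(T) Z\<^sub>y h\<close>. The left hand side starts with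
  \<open>n B(T) w y\<^bsup>n-1\<^esup>\<close> and the right hand side is divisible by \<open>y\<^sup>n\<close>; hence \<open>B(T) w\<close> vanishes on the
  axis, and so does \<open>T\<close> by the identity theorem. The equation for \<open>h\<close>, restricted to the axis, then
  says that \<open>Z\<^sup>2\<close> has derivative \<open>0\<close> there.
\<close>

lemma components_vanish_on_axis:
  assumes r: "r > 0" and T: "hol_on (polydisc r) T" and Z: "hol_on (polydisc r) Z"
    and h: "hol_on (polydisc r) h" and w: "hol_on (polydisc r) w"
    and A: "\<And>q. q \<in> polydisc r \<Longrightarrow> (A has_field_derivative A' (T q)) (at (T q))"
    and A': "\<And>q. q \<in> polydisc r \<Longrightarrow> isCont A' (T q)"
    and B: "\<And>q. q \<in> polydisc r \<Longrightarrow> (B has_field_derivative B' (T q)) (at (T q))"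
    and A0: "A 0 = 0" and B0: "\<And>t. B t = 0 \<longleftrightarrow> t = 0"
    and eq1: "\<And>q. q \<in> polydisc r \<Longrightarrow> B (T q) * pd 1 T q + (2 * Z q + A (T q)) * pd 1 Z q = h q"
    and eq2: "\<And>q. q \<in> polydisc r \<Longrightarrow> B (T q) * pd 2 T q + (2 * Z q + A (T q)) * pd 2 Z q = 0"
    and fact: "\<And>q. q \<in> polydisc r \<Longrightarrow> h q = (q $ 2) ^ n * w q" and n: "n > 0"
    and x1: "norm x1 < r" "w (vector [x1, 0]) \<noteq> 0"
    and Z0: "Z 0 = 0"
  shows "norm x < r \<Longrightarrow> T (vector [x, 0]) = 0" and "norm x < r \<Longrightarrow> Z (vector [x, 0]) = 0"
proof -
  have prod: "T (vector [x, 0]) * w (vector [x, 0]) = 0" if x: "norm x < r" for x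
  proof -
    define Q where "Q y = (vector [x, y] :: complex ^ 2)" for y
    have Q: "Q y \<in> polydisc r" if "norm y < r" for y using x that by (simp add: Q_def)
    \<comment> \<open>After substitution, the difference of the two sides of the identity is \<open>y\<^bsup>n-1\<^esup> k y\<close>.\<close>
    define k where "k y = B (T (Q y)) * (of_nat n * w (Q y) + y * pd 2 w (Q y))
        + A' (T (Q y)) * pd 2 Z (Q y) * y * w (Q y)" for y
    have cont: "isCont (\<lambda>y. H (Q y)) 0" if "hol_on (polydisc r) H" for H
      using holomorphic_on_imp_continuous_on[OF slice_holomorphic(1)[OF that x]] r
      by (simp add: continuous_on_eq_continuous_at Q_def)
    have "isCont k 0"
      unfolding k_def
      using isCont_o2[OF cont[OF T] DERIV_isCont[OF B[OF Q]]] isCont_o2[OF cont[OF T] A'[OF Q]] r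
        cont[OF w] cont[OF hol_on_pd[OF open_polydisc w, of 2]] cont[OF hol_on_pd[OF open_polydisc Z, of 2]]
      by (auto intro!: continuous_intros)
    moreover have "\<forall>\<^sub>F y in at 0. k y = 0"
      unfolding eventually_at
    proof (intro exI[of _ r] conjI ballI impI)
      fix y :: complex assume "y \<noteq> 0 \<and> dist y 0 < r"
      hence y: "y \<noteq> 0" "norm y < r" by auto
      note q = Q[OF y(2)]
      have "((\<lambda>y. y ^ n * w (Q y)) has_field_derivative
          of_nat n * y ^ (n - 1) * w (Q y) + y ^ n * pd 2 w (Q y)) (at y)"
        using slice2_has_field_derivative[OF hol_onD[OF w q, unfolded Q_def]]
        by (auto simp: Q_def intro!: derivative_eq_intros)
      moreover have "((\<lambda>y. y ^ n * w (Q y)) has_field_derivative pd 2 h (Q y)) (at y)"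
      proof (rule has_field_derivative_transform_within_open[of _ _ _ "ball 0 r"])
        show "((\<lambda>y. h (Q y)) has_field_derivative pd 2 h (Q y)) (at y)"
          using slice2_has_field_derivative[OF hol_onD[OF h q, unfolded Q_def]] by (simp add: Q_def)
        show "h (Q z) = z ^ n * w (Q z)" if "z \<in> ball 0 r" for z
          using fact[OF Q[of z]] that by (simp add: Q_def)
      qed (use y in auto)
      ultimately have h2: "pd 2 h (Q y) = of_nat n * y ^ (n - 1) * w (Q y) + y ^ n * pd 2 w (Q y)"
        using DERIV_unique by blast
      have yn: "y ^ n = y ^ (n - 1) * y" using n by (metis Suc_pred' power_Suc2)
      have "y ^ (n - 1) * k y = B (T (Q y)) * pd 2 h (Q y) + A' (T (Q y)) * pd 2 Z (Q y) * h (Q y)"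
        unfolding h2 fact[OF q] k_def yn by (simp add: Q_def yn algebra_simps)
      also have "\<dots> = 0"
        using pd_2_of_dx_coefficient(2)[OF T Z A B eq1 eq2 q] by simp
      finally show "k y = 0" using y(1) by simp
    qed (use r in simp)
    ultimately have "k 0 = 0" by (rule zero_if_continuous_and_zero_off_point)
    thus ?thesis using n B0 by (auto simp: k_def Q_def)
  qed
  show Tx: "T (vector [x, 0]) = 0" if "norm x < r" for x
    using holomorphic_product_zero[OF slice_holomorphic(2)[OF T] slice_holomorphic(2)[OF w], of 0 0 x1 x]
      prod x1 that r by simp
  have "((\<lambda>x. (Z (vector [x, 0]))\<^sup>2) has_field_derivative 0) (at x within ball 0 r)" if "x \<in> ball 0 r" for x
  proof -
    have q: "vector [x, 0] \<in> polydisc r" using that r by simp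
    have "2 * Z (vector [x, 0]) * pd 1 Z (vector [x, 0]) = h (vector [x, 0])"
      using eq1[OF q] Tx[of x] that A0 iffD2[OF B0[of 0] refl] by simp
    also have "\<dots> = 0" using fact[OF q] n by simp
    finally have "2 * Z (vector [x, 0]) * pd 1 Z (vector [x, 0]) = 0" .
    moreover have "((\<lambda>x. (Z (vector [x, 0]))\<^sup>2) has_field_derivative
        2 * Z (vector [x, 0]) * pd 1 Z (vector [x, 0])) (at x)"
      using slice1_has_field_derivative[OF hol_onD[OF Z q]] by (auto intro!: derivative_eq_intros)
    ultimately show ?thesis by (metis has_field_derivative_at_within)
  qed
  hence "\<exists>c. \<forall>x\<in>ball 0 r. (Z (vector [x, 0]))\<^sup>2 = c"
    by (rule has_field_derivative_zero_constant[OF convex_ball])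
  then obtain c where c: "\<And>x. x \<in> ball 0 r \<Longrightarrow> (Z (vector [x, 0]))\<^sup>2 = c" by blast
  have "(vector [0, 0] :: complex ^ 2) = 0" by (simp add: vec_eq_iff forall_2)
  hence "c = 0" using c[of 0] r Z0 by simp
  thus "Z (vector [x, 0]) = 0" if "norm x < r" for x using c[of x] that by simp
qed

text \<open>
  If \<open>T = 0\<close>, then \<open>h\<^sub>y = 0\<close>, and vanishing on the axis would force \<open>h = 0\<close>.
\<close>

lemma first_component_not_zero:
  assumes r: "r > 0" and T: "hol_on (polydisc r) T" and Z: "hol_on (polydisc r) Z"
    and h: "hol_on (polydisc r) h"
    and A: "\<And>q. q \<in> polydisc r \<Longrightarrow> (A has_field_derivative A' (T q)) (at (T q))"
    and B: "\<And>q. q \<in> polydisc r \<Longrightarrow> (B has_field_derivative B' (T q)) (at (T q))"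
    and eq1: "\<And>q. q \<in> polydisc r \<Longrightarrow> B (T q) * pd 1 T q + (2 * Z q + A (T q)) * pd 1 Z q = h q"
    and eq2: "\<And>q. q \<in> polydisc r \<Longrightarrow> B (T q) * pd 2 T q + (2 * Z q + A (T q)) * pd 2 Z q = 0"
    and ax: "\<And>x. norm x < r \<Longrightarrow> h (vector [x, 0]) = 0"
    and nz: "q0 \<in> polydisc r" "h q0 \<noteq> 0"
  obtains q where "q \<in> polydisc r" "T q \<noteq> 0"
proof (rule ccontr)
  assume "\<not> thesis"
  hence T0: "\<And>q. q \<in> polydisc r \<Longrightarrow> T q = 0" using that by blast
  have pdT: "pd i T q = 0" if "q \<in> polydisc r" for i q
  proof -
    have "\<forall>\<^sub>F x in nhds q. 0 = T x"
      using T0 open_polydisc that unfolding eventually_nhds by metis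
    from has_gradient_imp_pd[OF has_gradient_cong[OF has_gradient_const this]] show ?thesis by simp
  qed
  have x: "norm (q0 $ 1) < r" "norm (q0 $ 2) < r" using nz(1) by (auto simp: polydisc_def)
  have "((\<lambda>y. h (vector [q0 $ 1, y])) has_field_derivative 0) (at y within ball 0 r)" if "y \<in> ball 0 r" for y
  proof -
    have q: "vector [q0 $ 1, y] \<in> polydisc r" using x that by simp
    have "pd 2 h (vector [q0 $ 1, y]) = 0"
      using pd_2_of_dx_coefficient(1)[OF T Z A B eq1 eq2 q] pdT[OF q] by simp
    thus ?thesis using slice2_has_field_derivative[OF hol_onD[OF h q]]
      by (metis has_field_derivative_at_within)
  qed
  hence "\<exists>c. \<forall>y\<in>ball 0 r. h (vector [q0 $ 1, y]) = c"
    by (rule has_field_derivative_zero_constant[OF convex_ball])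
  then obtain c where c: "\<And>y. y \<in> ball 0 r \<Longrightarrow> h (vector [q0 $ 1, y]) = c" by blast
  have "h (vector [q0 $ 1, q0 $ 2]) = h (vector [q0 $ 1, 0])" using c x r by simp
  thus False using nz(2) ax[OF x(1)] by (simp add: vector_2_coordinates)
qed

section \<open>Holomorphic germs\<close>

lemma hol_germ_const: "hol_germ (\<lambda>_. c)"
  unfolding hol_germ_iff using has_gradient_const by (intro always_eventually) blast

lemma hol_germ_coordinate: "hol_germ (\<lambda>q. q $ i)"
  unfolding hol_germ_iff using has_gradient_coordinate by (intro always_eventually) blast

lemma hol_germ_add: "hol_germ f \<Longrightarrow> hol_germ g \<Longrightarrow> hol_germ (\<lambda>q. f q + g q)"
  unfolding hol_germ_iff by (erule (1) eventually_elim2) (blast intro: has_gradient_add)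

lemma hol_germ_mult: "hol_germ f \<Longrightarrow> hol_germ g \<Longrightarrow> hol_germ (\<lambda>q. f q * g q)"
  unfolding hol_germ_iff by (erule (1) eventually_elim2) (blast intro: has_gradient_mult)

lemma hol_germ_cong:
  assumes "hol_germ f" "\<forall>\<^sub>F q in nhds 0. f q = g q"
  shows "hol_germ g"
proof -
  have "\<forall>\<^sub>F q in nhds 0. \<forall>\<^sub>F x in nhds q. f x = g x" using assms(2) by (simp add: eventually_eventually)
  with assms(1)[unfolded hol_germ_iff] show ?thesis unfolding hol_germ_iff
    by (rule eventually_elim2) (blast intro: has_gradient_cong)
qed

lemma hol_germ_pd: "hol_germ f \<Longrightarrow> hol_germ (pd i f)"
  unfolding hol_germ_iff_ball using hol_on_pd open_ball by blast

lemma hol_germ_tendsto: "hol_germ f \<Longrightarrow> filterlim f (nhds (f 0)) (nhds 0)"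
  unfolding hol_germ_iff
  by (drule eventually_nhds_x_imp_x) (auto dest!: has_gradient_imp_continuous simp: tendsto_at_iff_tendsto_nhds continuous_at)

lemma hol_map_germ_tendsto:
  assumes "hol_map_germ \<phi>"
  shows "filterlim \<phi> (nhds 0) (nhds 0)"
proof (rule vec_tendstoI)
  fix i
  show "((\<lambda>q. \<phi> q $ i) \<longlongrightarrow> 0 $ i) (nhds 0)"
    using hol_germ_tendsto[of "\<lambda>q. \<phi> q $ i"] assms by (simp add: hol_map_germ_def)
qed

lemma hol_germ_field_compose:
  assumes "hol_germ f" "open S" "F holomorphic_on S" "f 0 \<in> S"
  shows "hol_germ (\<lambda>q. F (f q))"
proof -
  have "\<forall>\<^sub>F q in nhds 0. f q \<in> S"
    using hol_germ_tendsto[OF assms(1)] assms(2,4) by (simp add: topological_tendstoD)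
  with assms(1)[unfolded hol_germ_iff] show ?thesis unfolding hol_germ_iff
  proof (rule eventually_elim2)
    fix q assume "\<exists>G. has_gradient f G q" "f q \<in> S"
    then obtain G where "has_gradient f G q" "f q \<in> S" by blast
    from has_gradient_field_compose[OF this(1) holomorphic_derivI[OF assms(3,2) this(2)]]
    show "\<exists>G. has_gradient (\<lambda>q. F (f q)) G q" ..
  qed
qed

lemma hol_germ_compose:
  assumes "hol_germ f" "hol_map_germ \<phi>"
  shows "hol_germ (\<lambda>q. f (\<phi> q))"
proof -
  have "\<forall>\<^sub>F q in nhds 0. \<exists>G. has_gradient f G (\<phi> q)"
    using eventually_compose_filterlim[OF assms(1)[unfolded hol_germ_iff] hol_map_germ_tendsto[OF assms(2)]] .
  moreover have "\<forall>\<^sub>F q in nhds 0. \<forall>i. \<exists>G. has_gradient (\<lambda>q. \<phi> q $ i) G q"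
    using assms(2) by (intro eventually_all_finite) (simp add: hol_map_germ_def hol_germ_iff)
  ultimately show ?thesis unfolding hol_germ_iff
  proof (rule eventually_elim2)
    fix q assume 1: "\<exists>G. has_gradient f G (\<phi> q)" "\<forall>i. \<exists>G. has_gradient (\<lambda>q. \<phi> q $ i) G q"
    have 2: "has_gradient (\<lambda>q. \<phi> q $ i) (differential (\<lambda>q. \<phi> q $ i) q) q" for i
      using 1(2)[rule_format] by (rule has_gradient_differential)
    from 1(1) obtain G where "has_gradient f G (\<phi> q)" by blast
    from has_gradient_compose[OF this 2] show "\<exists>G. has_gradient (\<lambda>q. f (\<phi> q)) G q" ..
  qed
qed

lemma has_gradient_of_first_two_coordinates:
  fixes f :: "complex ^ 2 \<Rightarrow> complex" and q :: "complex ^ 3"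
  assumes "has_gradient f G (vector [q $ 1, q $ 2])"
  shows "has_gradient (\<lambda>q :: complex ^ 3. f (vector [q $ 1, q $ 2])) (G $ 1 *s axis 1 1 + G $ 2 *s axis 2 1) q"
proof -
  have "has_gradient (\<lambda>q :: complex ^ 3. vector [q $ 1, q $ 2] $ i) (if i = 1 then axis 1 1 else axis 2 1) q" for i :: 2
    using exhaust_2[of i] has_gradient_coordinate[of 1 q] has_gradient_coordinate[of 2 q] by auto
  from has_gradient_compose[where \<phi> = "\<lambda>q :: complex ^ 3. vector [q $ 1, q $ 2]", OF assms this]
  show ?thesis by (simp add: sum_2)
qed

section \<open>Pull-backs of a form in two variables\<close>

text \<open>
  The pull-back of \<open>B(t) dt + (2 z + A(t)) dz\<close> by the map with components \<open>t = T\<close> and \<open>z = Z\<close>. Both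
  foliations of the theorem are generated by such a form, with the same \<open>A\<close> and \<open>B\<close>.
\<close>

definition pullback_form ::
  "(complex \<Rightarrow> complex) \<Rightarrow> (complex \<Rightarrow> complex) \<Rightarrow> (complex ^ 'n \<Rightarrow> complex) \<Rightarrow> (complex ^ 'n \<Rightarrow> complex) \<Rightarrow> 'n::finite form"
  where "pullback_form A B T Z q = B (T q) *s differential T q + (2 * Z q + A (T q)) *s differential Z q"

lemma pullback_form_cong:
  assumes "\<forall>\<^sub>F q in nhds 0. T q = T' q" "\<forall>\<^sub>F q in nhds 0. Z q = Z' q"
  shows "\<forall>\<^sub>F q in nhds 0. pullback_form A B T Z q = pullback_form A B T' Z' q"
proof -
  have *: "differential g q = differential g' q" if "\<forall>\<^sub>F x in nhds q. g x = g' x" for g g' :: "complex ^ 'a \<Rightarrow> complex" and q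
  proof -
    have "pd j g q = pd j g' q" for j
      unfolding pd_def
    proof (rule deriv_cong_ev)
      have "((\<lambda>s. q + s *s axis j 1) \<longlongrightarrow> q + 0 *s axis j 1) (nhds (0::complex))"
        by (rule vec_tendstoI) (auto intro!: tendsto_eq_intros filterlim_ident)
      hence "filterlim (\<lambda>s. q + s *s axis j 1) (nhds q) (nhds (0::complex))" by simp
      from eventually_compose_filterlim[OF that this]
      show "\<forall>\<^sub>F s in nhds 0. g (q + s *s axis j 1) = g' (q + s *s axis j 1)" .
    qed simp
    thus ?thesis by (simp add: differential_def)
  qed
  have "\<forall>\<^sub>F q in nhds 0. (\<forall>\<^sub>F x in nhds q. T x = T' x) \<and> (\<forall>\<^sub>F x in nhds q. Z x = Z' x)"
    using assms by (simp add: eventually_conj_iff eventually_eventually)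
  thus ?thesis
  proof (rule eventually_mono)
    fix q assume ev: "(\<forall>\<^sub>F x in nhds q. T x = T' x) \<and> (\<forall>\<^sub>F x in nhds q. Z x = Z' x)"
    have "T q = T' q" "Z q = Z' q"
      using eventually_nhds_x_imp_x[OF conjunct1[OF ev]] eventually_nhds_x_imp_x[OF conjunct2[OF ev]] .
    thus "pullback_form A B T Z q = pullback_form A B T' Z' q"
      using *[OF conjunct1[OF ev]] *[OF conjunct2[OF ev]] by (simp add: pullback_form_def)
  qed
qed

text \<open>
  A pull-back of a form in two variables is integrable: its exterior derivative has the components
  \<open>A'(T) (T\<^sub>i Z\<^sub>j - T\<^sub>j Z\<^sub>i)\<close>, so the components of \<open>\<omega> \<and> d\<omega>\<close> are determinants with linearly dependent
  rows. It is nonzero because its coefficient in direction \<open>k\<close> is \<open>2 z + A(T)\<close> with \<open>T\<close> independent of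
  \<open>z\<close>.
\<close>

lemma foliation_form_pullback_form:
  fixes T :: "complex ^ 'n::finite \<Rightarrow> complex"
  assumes AB: "R > 0" "A holomorphic_on ball 0 R" "B holomorphic_on ball 0 R"
    and T: "hol_germ T" "T 0 = 0" and Tk: "\<forall>\<^sub>F q in nhds 0. pd k T q = 0"
    and \<omega>: "\<forall>\<^sub>F q in nhds 0. \<omega> q = pullback_form A B T (\<lambda>q. q $ k) q"
  shows "foliation_form \<omega>"
proof -
  define Z where "Z q = q $ k" for q :: "complex ^ 'n"
  have Z: "hol_germ Z" unfolding Z_def by (rule hol_germ_coordinate)
  have A_T: "hol_germ (\<lambda>q. A (T q))" and B_T: "hol_germ (\<lambda>q. B (T q))"
    using hol_germ_field_compose[OF T(1) open_ball] AB T(2) by simp_all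
  have C: "hol_germ (\<lambda>q. 2 * Z q + A (T q))"
    by (intro hol_germ_add hol_germ_mult hol_germ_const Z A_T)
  have comp: "\<forall>\<^sub>F q in nhds 0. B (T q) * pd i T q + (2 * Z q + A (T q)) * pd i Z q = \<omega> q $ i" for i
    using \<omega> by (rule eventually_mono) (simp add: pullback_form_def differential_def Z_def[abs_def] algebra_simps)
  have "hol_form \<omega>"
    unfolding hol_form_def
    by (intro allI hol_germ_cong[OF _ comp] hol_germ_add hol_germ_mult B_T C hol_germ_pd T(1) Z)
  moreover have "integrable_form \<omega>"
  proof -
    obtain r1 where r1: "r1 > 0" "hol_on (ball 0 r1) T" using T(1) hol_germ_iff_ball by blast
    have Zhol: "hol_on UNIV Z" unfolding Z_def using has_gradient_coordinate hol_on_def by blast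
    have "\<forall>\<^sub>F q in nhds 0. \<forall>i. \<forall>\<^sub>F x in nhds q. B (T x) * pd i T x + (2 * Z x + A (T x)) * pd i Z x = \<omega> x $ i"
      using comp by (intro eventually_all_finite) (simp add: eventually_eventually)
    moreover have "\<forall>\<^sub>F q in nhds 0. q \<in> ball 0 r1" using r1(1) eventually_nhds_in_open by force
    moreover have "\<forall>\<^sub>F q in nhds 0. T q \<in> ball 0 R"
      by (rule topological_tendstoD[OF hol_germ_tendsto[OF T(1)] open_ball]) (use AB(1) T(2) in simp)
    ultimately have "\<forall>\<^sub>F q in nhds 0. \<forall>i j. \<omega> q $ i = B (T q) * pd i T q + (2 * Z q + A (T q)) * pd i Z q \<and>
       pd i (\<lambda>q. \<omega> q $ j) q - pd j (\<lambda>q. \<omega> q $ i) q = deriv A (T q) * (pd i T q * pd j Z q - pd j T q * pd i Z q)"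
    proof eventually_elim
      case (elim q)
      note gr = hol_onD[OF r1(2) elim(2)] hol_onD[OF Zhol UNIV_I[of q]]
        hol_onD[OF hol_on_pd[OF open_ball r1(2)] elim(2)] hol_onD[OF hol_on_pd[OF open_UNIV Zhol] UNIV_I[of q]]
      note DA = holomorphic_derivI[OF AB(2) open_ball elim(3)]
      note DB = holomorphic_derivI[OF AB(3) open_ball elim(3)]
      note C = has_gradient_add[OF has_gradient_mult[OF has_gradient_const[of 2] gr(2)]
        has_gradient_field_compose[OF gr(1) DA]]
      have "pd i (\<lambda>q. \<omega> q $ j) q = B (T q) * pd i (pd j T) q + pd j T q * (deriv B (T q) * pd i T q) +
      ((2 * Z q + A (T q)) * pd i (pd j Z) q + pd j Z q * (2 * pd i Z q + deriv A (T q) * pd i T q))" for i j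
        using has_gradient_imp_pd[OF has_gradient_cong[OF
          has_gradient_add[OF has_gradient_mult[OF has_gradient_field_compose[OF gr(1) DB] gr(3)]
          has_gradient_mult[OF C gr(4)]] elim(1)[rule_format, of j]], of i]
        by (simp add: differential_def algebra_simps)
      moreover have "\<omega> q $ i = B (T q) * pd i T q + (2 * Z q + A (T q)) * pd i Z q" for i
        using eventually_nhds_x_imp_x[OF elim(1)[rule_format, of i]] by simp
      moreover have "pd i (pd j T) q = pd j (pd i T) q" "pd i (pd j Z) q = pd j (pd i Z) q" for i j
        using pd_commute[OF open_ball r1(2) elim(2)] pd_commute[OF open_UNIV Zhol UNIV_I] by blast+
      ultimately show ?case by (simp add: algebra_simps)
    qed
    hence "\<forall>\<^sub>F q in nhds 0.
       \<omega> q $ i * (pd j (\<lambda>q. \<omega> q $ k) q - pd k (\<lambda>q. \<omega> q $ j) q) +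
       \<omega> q $ j * (pd k (\<lambda>q. \<omega> q $ i) q - pd i (\<lambda>q. \<omega> q $ k) q) +
       \<omega> q $ k * (pd i (\<lambda>q. \<omega> q $ j) q - pd j (\<lambda>q. \<omega> q $ i) q) = 0" for i j k
    proof (rule eventually_mono)
      fix q
      assume "\<forall>i j. \<omega> q $ i = B (T q) * pd i T q + (2 * Z q + A (T q)) * pd i Z q \<and>
       pd i (\<lambda>q. \<omega> q $ j) q - pd j (\<lambda>q. \<omega> q $ i) q = deriv A (T q) * (pd i T q * pd j Z q - pd j T q * pd i Z q)"
      hence w: "\<And>i. \<omega> q $ i = B (T q) * pd i T q + (2 * Z q + A (T q)) * pd i Z q"
        and d: "\<And>i j. pd i (\<lambda>q. \<omega> q $ j) q - pd j (\<lambda>q. \<omega> q $ i) q =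
          deriv A (T q) * (pd i T q * pd j Z q - pd j T q * pd i Z q)" by blast+
      show "\<omega> q $ i * (pd j (\<lambda>q. \<omega> q $ k) q - pd k (\<lambda>q. \<omega> q $ j) q) +
       \<omega> q $ j * (pd k (\<lambda>q. \<omega> q $ i) q - pd i (\<lambda>q. \<omega> q $ k) q) +
       \<omega> q $ k * (pd i (\<lambda>q. \<omega> q $ j) q - pd j (\<lambda>q. \<omega> q $ i) q) = 0"
        unfolding d w by (simp add: algebra_simps)
    qed
    thus ?thesis unfolding integrable_form_def Let_def by blast
  qed
  moreover have "\<not> form_zero \<omega>"
  proof
    assume "form_zero \<omega>"
    hence "\<forall>\<^sub>F q in nhds 0. \<omega> q $ k = 0" unfolding form_zero_def by (rule eventually_mono) simp
    hence ev: "\<forall>\<^sub>F q in nhds 0. B (T q) * pd k T q + (2 * Z q + A (T q)) * pd k Z q = 0"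
      using comp[of k] by eventually_elim simp
    have Zk: "pd k Z = (\<lambda>_. 1)"
      unfolding Z_def[abs_def]
      by (rule ext) (simp add: has_gradient_imp_pd[OF has_gradient_coordinate] axis_def)
    have "\<forall>\<^sub>F q in nhds 0. 2 * Z q + A (T q) = 0"
      using ev Tk by eventually_elim (simp add: Zk)
    moreover have "has_gradient (\<lambda>q. 2 * Z q + A (T q))
        (2 *s axis k 1 + Z 0 *s 0 + deriv A (T 0) *s differential T 0) 0"
      unfolding Z_def
    proof (intro has_gradient_add has_gradient_mult has_gradient_const has_gradient_coordinate
        has_gradient_field_compose[where F = A])
      show "has_gradient T (differential T 0) 0"
        using eventually_nhds_x_imp_x[OF T(1)[unfolded hol_germ_iff]] by (rule has_gradient_differential)
      show "(A has_field_derivative deriv A (T 0)) (at (T 0))"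
        using holomorphic_derivI[OF AB(2) open_ball, of "T 0"] AB(1) T(2) by simp
    qed
    ultimately have grad0: "has_gradient (\<lambda>_. 0) (2 *s axis k 1 + Z 0 *s 0 + deriv A (T 0) *s differential T 0) 0"
      by (rule has_gradient_cong[rotated])
    have "(2 *s axis k 1 + Z 0 *s 0 + deriv A (T 0) *s differential T 0) $ k = 0 $ k"
      using has_gradient_imp_pd[OF grad0, of k] has_gradient_imp_pd[OF has_gradient_const[of 0 "0 :: complex ^ 'n"], of k]
      by simp
    hence "(2::complex) = 0"
      using eventually_nhds_x_imp_x[OF Tk] by (simp add: differential_def)
    thus False by simp
  qed
  ultimately show ?thesis unfolding foliation_form_def by blast
qed

section \<open>Dicritical foliations\<close>

lemma tendsto_vector_2:
  assumes "(f \<longlongrightarrow> a) F" "(g \<longlongrightarrow> b) F"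
  shows "((\<lambda>x. vector [f x, g x] :: complex ^ 2) \<longlongrightarrow> vector [a, b]) F"
proof (rule vec_tendstoI)
  fix i :: 2
  show "((\<lambda>x. vector [f x, g x] $ i) \<longlongrightarrow> vector [a, b] $ i) F"
    using exhaust_2[of i] assms by auto
qed

lemma vector_2_zero: "vector [0, 0] = (0 :: complex ^ 2)"
  by (simp add: vec_eq_iff forall_2)

lemma eventually_nhds_complex_1:
  "(\<forall>\<^sub>F s in nhds (0 :: complex ^ 1). P (s $ 1)) \<longleftrightarrow> (\<forall>\<^sub>F x in nhds 0. P x)"
proof
  assume ev: "\<forall>\<^sub>F s in nhds (0 :: complex ^ 1). P (s $ 1)"
  have "((\<lambda>x. vector [x] :: complex ^ 1) \<longlongrightarrow> 0) (nhds 0)"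
  proof (rule vec_tendstoI)
    have "\<forall>i. ((\<lambda>x. (vector [x] :: complex ^ 1) $ i) \<longlongrightarrow> 0 $ i) (nhds 0)"
      by (simp add: forall_1 filterlim_ident)
    thus "((\<lambda>x. (vector [x] :: complex ^ 1) $ i) \<longlongrightarrow> 0 $ i) (nhds 0)" for i ..
  qed
  from eventually_compose_filterlim[OF ev this] show "\<forall>\<^sub>F x in nhds 0. P x" by simp
next
  assume ev: "\<forall>\<^sub>F x in nhds 0. P x"
  have "((\<lambda>s :: complex ^ 1. s $ 1) \<longlongrightarrow> (0 :: complex ^ 1) $ 1) (nhds 0)" by (intro tendsto_vec_nth filterlim_ident)
  hence "filterlim (\<lambda>s :: complex ^ 1. s $ 1) (nhds 0) (nhds 0)" by simp
  from eventually_compose_filterlim[OF ev this]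
  show "\<forall>\<^sub>F s in nhds (0 :: complex ^ 1). P (s $ 1)" .
qed

lemma differential_coordinate: "differential (\<lambda>q. q $ i) = (\<lambda>_. axis i 1)"
  by (rule ext) (rule has_gradient_imp_differential[OF has_gradient_coordinate])

lemma hol_map_germ_has_gradient:
  assumes "hol_map_germ \<phi>"
  shows "\<forall>\<^sub>F q in nhds 0. \<forall>i. has_gradient (\<lambda>q. \<phi> q $ i) (differential (\<lambda>q. \<phi> q $ i) q) q"
proof (intro eventually_all_finite)
  fix i
  have "\<forall>\<^sub>F q in nhds 0. \<exists>G. has_gradient (\<lambda>q. \<phi> q $ i) G q"
    using assms by (simp add: hol_map_germ_def hol_germ_iff)
  thus "\<forall>\<^sub>F q in nhds 0. has_gradient (\<lambda>q. \<phi> q $ i) (differential (\<lambda>q. \<phi> q $ i) q) q"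
    by (rule eventually_mono) (rule has_gradient_differential)
qed

text \<open>
  Restricting to the axis keeps only the \<open>dx\<close> coefficient of the pull-back.
\<close>

lemma pullback_axis_zero_iff:
  fixes \<phi> :: "complex ^ 2 \<Rightarrow> complex ^ 'n::finite"
  assumes \<phi>: "hol_map_germ \<phi>" and h: "\<forall>\<^sub>F q in nhds 0. pullback \<phi> \<omega> q = h q *s axis 1 1"
  shows "form_zero (pullback (\<lambda>s :: complex ^ 1. \<phi> (vector [s $ 1, 0])) \<omega>) \<longleftrightarrow>
    (\<forall>\<^sub>F x in nhds 0. h (vector [x, 0]) = 0)"
proof -
  let ?\<sigma> = "\<lambda>s :: complex ^ 1. vector [s $ 1, 0] :: complex ^ 2"
  have "((\<lambda>s :: complex ^ 1. s $ 1) \<longlongrightarrow> (0 :: complex ^ 1) $ 1) (nhds 0)" by (intro tendsto_vec_nth filterlim_ident)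
  from tendsto_vector_2[OF this tendsto_const[of 0]]
  have lim: "filterlim ?\<sigma> (nhds 0) (nhds 0)" by (simp add: vector_2_zero)
  have ev: "\<forall>\<^sub>F s in nhds 0. pullback (\<lambda>s :: complex ^ 1. \<phi> (?\<sigma> s)) \<omega> s = h (?\<sigma> s) *s axis 1 1"
    using eventually_compose_filterlim[OF h lim]
      eventually_compose_filterlim[OF hol_map_germ_has_gradient[OF \<phi>] lim]
  proof eventually_elim
    case (elim s)
    have "has_gradient (\<lambda>s. ?\<sigma> s $ i) (if i = 1 then axis 1 1 else 0) s" for i
      using exhaust_2[of i] has_gradient_coordinate[of 1 s] has_gradient_const[of 0 s] by auto
    from has_gradient_imp_differential[OF has_gradient_compose[OF elim(2)[rule_format] this]]
    have "differential (\<lambda>s. \<phi> (?\<sigma> s) $ i) s = differential (\<lambda>q. \<phi> q $ i) (?\<sigma> s) $ 1 *s axis 1 1" for i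
      by (simp add: sum_2)
    hence "pullback (\<lambda>s. \<phi> (?\<sigma> s)) \<omega> s = pullback \<phi> \<omega> (?\<sigma> s) $ 1 *s axis 1 1"
      by (simp add: pullback_def vec.scale_sum_left)
    thus ?case using elim(1) by (simp add: axis_def)
  qed
  have "form_zero (pullback (\<lambda>s :: complex ^ 1. \<phi> (?\<sigma> s)) \<omega>) \<longleftrightarrow> (\<forall>\<^sub>F s in nhds (0 :: complex ^ 1). h (vector [s $ 1, 0]) = 0)"
    unfolding form_zero_def
  proof (rule eventually_subst)
    show "\<forall>\<^sub>F s in nhds 0. (pullback (\<lambda>s :: complex ^ 1. \<phi> (?\<sigma> s)) \<omega> s = 0) = (h (vector [s $ 1, 0]) = 0)"
      using ev by (rule eventually_mono) (simp add: vec_eq_iff axis_def)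
  qed
  also have "\<dots> \<longleftrightarrow> (\<forall>\<^sub>F x in nhds 0. h (vector [x, 0]) = 0)" by (rule eventually_nhds_complex_1)
  finally show ?thesis .
qed

text \<open>
  Saturating \<open>h dx\<close> gives \<open>dx\<close> whatever \<open>h\<close> is, so the existential over saturations says only that
  the pull-back is some multiple \<open>h dx\<close>; invariance of the image of the axis means that \<open>h\<close> vanishes
  there.
\<close>

lemma dicritical_iff:
  fixes \<omega> :: "'n::finite form"
  shows "dicritical \<omega> \<longleftrightarrow> foliation_form \<omega> \<and>
    (\<exists>\<phi> :: complex ^ 2 \<Rightarrow> complex ^ 'n. \<exists>h. hol_map_germ \<phi> \<and> hol_germ h \<and> \<not> (\<forall>\<^sub>F q in nhds 0. h q = 0) \<and>
      (\<forall>\<^sub>F q in nhds 0. pullback \<phi> \<omega> q = h q *s axis 1 1) \<and> (\<forall>\<^sub>F x in nhds 0. h (vector [x, 0]) = 0))"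
    (is "_ \<longleftrightarrow> _ \<and> ?R")
proof -
  have nonzero: "form_zero \<theta> \<longleftrightarrow> (\<forall>\<^sub>F q in nhds 0. h q = 0)"
    if "\<forall>\<^sub>F q in nhds 0. \<theta> q = h q *s axis 1 1" for \<theta> :: "2 form" and h
    unfolding form_zero_def
    by (rule eventually_subst, rule eventually_mono[OF that]) (simp add: vec_eq_iff axis_def forall_2)
  have sat: "(\<exists>\<eta>. is_saturation \<theta> \<eta> \<and> same_foliation \<eta> (differential (\<lambda>q. q $ 1))) \<longleftrightarrow>
     (\<exists>h. hol_germ h \<and> (\<forall>\<^sub>F q in nhds 0. \<theta> q = h q *s axis 1 1))" for \<theta> :: "2 form"
  proof
    assume "\<exists>\<eta>. is_saturation \<theta> \<eta> \<and> same_foliation \<eta> (differential (\<lambda>q. q $ 1))"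
    then obtain \<eta> g u where g: "hol_germ g" "\<forall>\<^sub>F q in nhds 0. \<theta> q = g q *s \<eta> q"
      and u: "hol_germ u" "\<forall>\<^sub>F q in nhds 0. \<eta> q = u q *s axis 1 1"
      unfolding is_saturation_def same_foliation_def differential_coordinate by blast
    have "\<forall>\<^sub>F q in nhds 0. \<theta> q = (g q * u q) *s axis 1 1"
      using g(2) u(2) by eventually_elim simp
    thus "\<exists>h. hol_germ h \<and> (\<forall>\<^sub>F q in nhds 0. \<theta> q = h q *s axis 1 1)"
      using hol_germ_mult[OF g(1) u(1)] by blast
  next
    assume "\<exists>h. hol_germ h \<and> (\<forall>\<^sub>F q in nhds 0. \<theta> q = h q *s axis 1 1)"
    then obtain h where h: "hol_germ h" "\<forall>\<^sub>F q in nhds 0. \<theta> q = h q *s axis 1 1" by blast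
    have "no_common_factor (\<lambda>_ :: complex ^ 2. axis 1 1 :: complex ^ 2)"
      unfolding no_common_factor_def
    proof (intro allI impI)
      fix d :: "complex ^ 2 \<Rightarrow> complex"
      assume "hol_germ d \<and> (\<forall>i. germ_dvd d (\<lambda>q. (axis 1 1 :: complex ^ 2) $ i))"
      hence "germ_dvd d (\<lambda>q. (axis 1 1 :: complex ^ 2) $ 1)" by blast
      then obtain e where "\<forall>\<^sub>F q in nhds 0. (axis 1 1 :: complex ^ 2) $ 1 = d q * e q"
        unfolding germ_dvd_def by blast
      from eventually_nhds_x_imp_x[OF this] show "d 0 \<noteq> 0" by (auto simp: axis_def)
    qed
    hence "is_saturation \<theta> (\<lambda>_. axis 1 1)"
      using h unfolding is_saturation_def hol_form_def by (auto intro: hol_germ_const)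
    moreover have "same_foliation (\<lambda>_. axis 1 1) (differential (\<lambda>q :: complex ^ 2. q $ 1))"
      unfolding same_foliation_def differential_coordinate
      by (intro exI[of _ "\<lambda>_. 1"]) (simp add: hol_germ_const)
    ultimately show "\<exists>\<eta>. is_saturation \<theta> \<eta> \<and> same_foliation \<eta> (differential (\<lambda>q. q $ 1))" by blast
  qed
  have "(hol_map_germ \<phi> \<and> \<not> form_zero (pullback \<phi> \<omega>) \<and>
      (\<exists>\<eta>. is_saturation (pullback \<phi> \<omega>) \<eta> \<and> same_foliation \<eta> (differential (\<lambda>q. q $ 1))) \<and>
      form_zero (pullback (\<lambda>s :: complex ^ 1. \<phi> (vector [s $ 1, 0])) \<omega>)) \<longleftrightarrow>
    (\<exists>h. hol_map_germ \<phi> \<and> hol_germ h \<and> \<not> (\<forall>\<^sub>F q in nhds 0. h q = 0) \<and>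
      (\<forall>\<^sub>F q in nhds 0. pullback \<phi> \<omega> q = h q *s axis 1 1) \<and> (\<forall>\<^sub>F x in nhds 0. h (vector [x, 0]) = 0))"
    for \<phi> :: "complex ^ 2 \<Rightarrow> complex ^ 'n"
    unfolding sat using nonzero[of "pullback \<phi> \<omega>"] pullback_axis_zero_iff[of \<phi> \<omega>] by blast
  thus ?thesis unfolding dicritical_def by (simp only:)
qed

lemma pullback_pullback_form:
  fixes \<phi> :: "complex ^ 'm::finite \<Rightarrow> complex ^ 'n::finite"
  assumes "has_gradient T G (\<phi> q)" "has_gradient Z H (\<phi> q)" "\<And>i. has_gradient (\<lambda>q. \<phi> q $ i) (M i) q"
    and "\<omega> (\<phi> q) = pullback_form A B T Z (\<phi> q)"
  shows "pullback \<phi> \<omega> q = pullback_form A B (\<lambda>q. T (\<phi> q)) (\<lambda>q. Z (\<phi> q)) q"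
proof -
  have d: "differential T (\<phi> q) = G" "differential Z (\<phi> q) = H" "differential (\<lambda>q. \<phi> q $ i) q = M i"
    "differential (\<lambda>q. T (\<phi> q)) q = (\<Sum>i\<in>UNIV. G $ i *s M i)"
    "differential (\<lambda>q. Z (\<phi> q)) q = (\<Sum>i\<in>UNIV. H $ i *s M i)" for i
    using assms(1-3) by (auto intro!: has_gradient_imp_differential has_gradient_compose)
  show ?thesis
    unfolding pullback_def assms(4) pullback_form_def d
    by (simp add: vec_eq_iff sum.distrib sum_distrib_left algebra_simps)
qed

text \<open>
  The condition that remains of dicriticality: it sees a candidate map only through the two
  functions \<open>T\<close> and \<open>Z\<close>. The comparison of the two foliations thereby becomes a question about
  which first components \<open>T\<close> are of the form \<open>f \<circ> g\<close>.
\<close>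

definition dicritical_pair ::
  "(complex \<Rightarrow> complex) \<Rightarrow> (complex \<Rightarrow> complex) \<Rightarrow> (complex ^ 2 \<Rightarrow> complex) \<Rightarrow> (complex ^ 2 \<Rightarrow> complex) \<Rightarrow> bool"
  where "dicritical_pair A B T Z \<longleftrightarrow>
    (\<exists>h. hol_germ h \<and> \<not> (\<forall>\<^sub>F q in nhds 0. h q = 0) \<and>
      (\<forall>\<^sub>F q in nhds 0. pullback_form A B T Z q = h q *s axis 1 1) \<and> (\<forall>\<^sub>F x in nhds 0. h (vector [x, 0]) = 0))"

lemma dicritical_iff_pair:
  fixes \<omega> :: "'n::finite form"
  assumes T: "hol_germ T" and Z: "hol_germ Z"
    and \<omega>: "\<forall>\<^sub>F q in nhds 0. \<omega> q = pullback_form A B T Z q"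
  shows "dicritical \<omega> \<longleftrightarrow> foliation_form \<omega> \<and>
    (\<exists>\<phi>. hol_map_germ \<phi> \<and> dicritical_pair A B (\<lambda>q. T (\<phi> q)) (\<lambda>q. Z (\<phi> q)))"
proof -
  have "(\<forall>\<^sub>F q in nhds 0. pullback \<phi> \<omega> q = h q *s axis 1 1) \<longleftrightarrow>
     (\<forall>\<^sub>F q in nhds 0. pullback_form A B (\<lambda>q. T (\<phi> q)) (\<lambda>q. Z (\<phi> q)) q = h q *s axis 1 1)"
    if \<phi>: "hol_map_germ \<phi>" for \<phi> :: "complex ^ 2 \<Rightarrow> complex ^ 'n" and h
  proof (rule eventually_subst)
    note lim = hol_map_germ_tendsto[OF \<phi>]
    show "\<forall>\<^sub>F q in nhds 0. (pullback \<phi> \<omega> q = h q *s axis 1 1) =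
        (pullback_form A B (\<lambda>q. T (\<phi> q)) (\<lambda>q. Z (\<phi> q)) q = h q *s axis 1 1)"
      using hol_map_germ_has_gradient[OF \<phi>] eventually_compose_filterlim[OF \<omega> lim]
        eventually_compose_filterlim[OF T[unfolded hol_germ_iff] lim]
        eventually_compose_filterlim[OF Z[unfolded hol_germ_iff] lim]
    proof eventually_elim
      case (elim q)
      show ?case
        using pullback_pullback_form[where \<phi> = \<phi> and q = q and \<omega> = \<omega>, OF has_gradient_differential[OF elim(3)]
          has_gradient_differential[OF elim(4)] elim(1)[rule_format] elim(2)] by (simp only:)
    qed
  qed
  thus ?thesis unfolding dicritical_iff dicritical_pair_def by blast
qed

section \<open>Roots and local coordinates\<close>

text \<open>
  On the disc of radius \<open>norm c\<close> around \<open>c\<close> the quotient \<open>u / c\<close> has positive real part, so that the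
  principal logarithm of \<open>u / c\<close> is holomorphic there.
\<close>

lemma local_holomorphic_root:
  assumes "c \<noteq> 0" "k > 0"
  shows "\<exists>F. F holomorphic_on ball c (norm c) \<and> (\<forall>u\<in>ball c (norm c). F u ^ k = u)"
proof (intro exI conjI ballI)
  have pos: "u / c \<notin> \<real>\<^sub>\<le>\<^sub>0" if "u \<in> ball c (norm c)" for u
  proof
    assume "u / c \<in> \<real>\<^sub>\<le>\<^sub>0"
    then obtain x where x: "u / c = of_real x" "x \<le> 0" by (auto elim!: nonpos_Reals_cases)
    have "norm (c - u) = norm c * norm (1 - u / c)"
      using assms(1) by (simp add: norm_mult[symmetric] right_diff_distrib)
    also have "norm (1 - u / c) = 1 - x"
      using x(2) norm_of_real[of "1 - x", where 'a = complex] unfolding x(1) by simp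
    finally have "norm c \<le> norm (c - u)"
      using x(2) by (simp add: mult_le_cancel_left1 right_diff_distrib mult_nonneg_nonpos)
    thus False using that by (simp add: dist_norm)
  qed
  show "(\<lambda>u. exp ((Ln c + Ln (u / c)) / of_nat k)) holomorphic_on ball c (norm c)"
    using pos assms by (intro holomorphic_intros) auto
  fix u assume u: "u \<in> ball c (norm c)"
  hence "u \<noteq> 0" by auto
  have "exp ((Ln c + Ln (u / c)) / of_nat k) ^ k = exp (Ln c + Ln (u / c))"
    using assms(2) by (simp add: exp_of_nat_mult[symmetric])
  thus "exp ((Ln c + Ln (u / c)) / of_nat k) ^ k = u"
    using assms(1) \<open>u \<noteq> 0\<close> by (simp add: exp_add)
qed

lemma norm_scale_vec: "norm (s *s (v :: complex ^ 'n::finite)) = norm s * norm v"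
  by (simp add: norm_vec_def L2_set_right_distrib norm_mult)

text \<open>
  On a complex line through the origin on which \<open>f\<close> is not identically zero, \<open>f\<close> is the \<open>k\<close>-th power
  of a local coordinate, \<open>k\<close> being its order of vanishing; \<open>\<gamma>\<close> is the inverse of that coordinate.
  Consequently every \<open>k\<close>-th power of a germ vanishing at the origin factors through \<open>f\<close>.
\<close>

lemma germ_is_power_on_curve:
  fixes f :: "complex ^ 'n::finite \<Rightarrow> complex"
  assumes f: "hol_germ f" "f 0 = 0" and nz: "\<not> (\<forall>\<^sub>F q in nhds 0. f q = 0)"
  obtains k a \<gamma> \<delta> where "k > 0" "\<delta> > 0" "\<gamma> holomorphic_on ball 0 \<delta>" "\<gamma> 0 = 0"
    "\<forall>w\<in>ball 0 \<delta>. f (\<gamma> w *s a) = w ^ k"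
proof -
  obtain r where r: "r > 0" "hol_on (ball 0 r) f" using f(1) hol_germ_iff_ball by blast
  have "\<not> (\<forall>q\<in>ball 0 r. f q = 0)"
    using nz r(1) unfolding eventually_nhds by (metis centre_in_ball open_ball)
  then obtain a where a: "norm a < r" "f a \<noteq> 0" by auto
  hence "norm a > 0" using f(2) by auto
  define g where "g s = f (s *s a)" for s
  have line: "s *s a \<in> ball 0 r" if "s \<in> ball 0 (r / norm a)" for s
    using that \<open>norm a > 0\<close> by (simp add: norm_scale_vec field_simps)
  have g: "g holomorphic_on ball 0 (r / norm a)"
  proof -
    have "(\<lambda>s. f (0 + s *s a)) holomorphic_on ball 0 (r / norm a)"
      by (rule hol_on_imp_holomorphic_line[OF r(2)]) (use line in simp)
    thus ?thesis by (simp add: g_def[abs_def])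
  qed
  have one: "1 \<in> ball (0::complex) (r / norm a)" using a(1) \<open>norm a > 0\<close> by simp
  have zero: "0 \<in> ball (0::complex) (r / norm a)" using r(1) \<open>norm a > 0\<close> by simp
  have g0: "g 0 = 0" and g1: "g 1 \<noteq> 0" using f(2) a(2) by (simp_all add: g_def)
  have "\<not> g constant_on ball 0 (r / norm a)"
    using g0 g1 one zero unfolding constant_on_def by metis
  note factor = holomorphic_factor_zero_nonconstant[OF g open_ball connected_ball zero g0 this]
  obtain k s u where k: "k > 0" and s: "s > 0" and u: "u holomorphic_on ball 0 s"
    "\<forall>w\<in>ball 0 s. g w = w ^ k * u w" "\<forall>w\<in>ball 0 s. u w \<noteq> 0"
  proof (rule factor)
    fix u s k
    assume *: "0 < k" "0 < s" "u holomorphic_on ball 0 s" "\<And>w. w \<in> ball 0 s \<Longrightarrow> g w = (w - 0) ^ k * u w"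
      "\<And>w. w \<in> ball 0 s \<Longrightarrow> u w \<noteq> 0"
    have "\<forall>w\<in>ball 0 s. g w = w ^ k * u w" "\<forall>w\<in>ball 0 s. u w \<noteq> 0" using *(4,5) by simp_all
    thus thesis by (rule that[OF *(1-3)])
  qed
  have u0: "u 0 \<noteq> 0" using u(3) s by simp
  obtain F where F: "F holomorphic_on ball (u 0) (norm (u 0))"
    "\<And>z. z \<in> ball (u 0) (norm (u 0)) \<Longrightarrow> F z ^ k = z"
    using local_holomorphic_root[OF u0 k] by blast
  have "isCont u 0" using holomorphic_on_imp_continuous_on[OF u(1)] s by (simp add: continuous_on_eq_continuous_at)
  then obtain e where e: "e > 0" "\<And>y. dist y 0 < e \<Longrightarrow> dist (u y) (u 0) < norm (u 0)"
    unfolding continuous_at_eps_delta using u0 by (metis zero_less_norm_iff)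
  define d where "d = min e s"
  have d: "d > 0" "ball (0::complex) d \<subseteq> ball 0 s" using e(1) s by (auto simp: d_def)
  have ud: "u y \<in> ball (u 0) (norm (u 0))" if "y \<in> ball 0 d" for y
    using e(2)[of y] that by (simp add: d_def dist_commute)
  define \<rho> where "\<rho> y = y * F (u y)" for y
  have Fu: "(\<lambda>y. F (u y)) holomorphic_on ball 0 d"
    by (rule holomorphic_on_compose_gen[OF holomorphic_on_subset[OF u(1) d(2)] F(1), unfolded o_def]) (use ud in blast)
  hence \<rho>: "\<rho> holomorphic_on ball 0 d" unfolding \<rho>_def by (intro holomorphic_intros)
  have "(\<rho> has_field_derivative 0 * deriv (\<lambda>y. F (u y)) 0 + F (u 0)) (at 0)"
    unfolding \<rho>_def
    using holomorphic_derivI[OF Fu open_ball, of 0] d(1) by (auto intro!: derivative_eq_intros)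
  hence "deriv \<rho> 0 = F (u 0)" by (simp add: DERIV_imp_deriv)
  moreover have "F (u 0) ^ k = u 0" using F(2)[OF ud[of 0]] d(1) by simp
  ultimately have "deriv \<rho> 0 \<noteq> 0" using u0 k zero_power[of k] by metis
  have "0 \<in> ball (0::complex) d" using d(1) by simp
  obtain e' where e': "e' > 0" "ball 0 e' \<subseteq> ball (0::complex) d" "inj_on \<rho> (ball 0 e')"
    using has_complex_derivative_locally_injective[OF \<rho> \<open>0 \<in> ball 0 d\<close> open_ball \<open>deriv \<rho> 0 \<noteq> 0\<close>] by blast
  have \<rho>': "\<rho> holomorphic_on ball 0 e'" using \<rho> e'(2) holomorphic_on_subset by blast
  obtain \<gamma> where \<gamma>: "\<gamma> holomorphic_on \<rho> ` ball 0 e'" "\<And>z. z \<in> ball 0 e' \<Longrightarrow> \<gamma> (\<rho> z) = z"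
    using holomorphic_has_inverse[OF \<rho>' open_ball e'(3)] by metis
  have "open (\<rho> ` ball 0 e')" by (rule open_mapping_thm3[OF \<rho>' open_ball e'(3)])
  moreover have \<rho>0: "\<rho> 0 = 0" by (simp add: \<rho>_def)
  hence "0 \<in> \<rho> ` ball 0 e'" using e'(1) by (intro image_eqI[of _ _ 0]) auto
  ultimately obtain \<delta> where \<delta>: "\<delta> > 0" "ball 0 \<delta> \<subseteq> \<rho> ` ball 0 e'" using openE by blast
  show thesis
  proof (rule that[OF k \<delta>(1)])
    show "\<gamma> holomorphic_on ball 0 \<delta>" using \<gamma>(1) \<delta>(2) holomorphic_on_subset by blast
    show "\<gamma> 0 = 0" using \<gamma>(2)[of 0] e'(1) \<rho>0 by simp
    show "\<forall>w\<in>ball 0 \<delta>. f (\<gamma> w *s a) = w ^ k"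
    proof
      fix w :: complex assume "w \<in> ball 0 \<delta>"
      then obtain z where z: "z \<in> ball 0 e'" "w = \<rho> z" using \<delta>(2) by blast
      have zd: "z \<in> ball 0 d" using z(1) e'(2) by blast
      have "f (\<gamma> w *s a) = z ^ k * u z" using \<gamma>(2)[OF z(1)] z(2) u(2) zd d(2) by (auto simp: g_def)
      also have "\<dots> = w ^ k" using F(2)[OF ud[OF zd]] by (simp add: z(2) \<rho>_def power_mult_distrib)
      finally show "f (\<gamma> w *s a) = w ^ k" .
    qed
  qed
qed

text \<open>
  The factorizations \<open>T = y\<^sup>m v\<close> and \<open>h = y\<^sup>n w\<close> hold on a common polydisc, and \<open>v w\<close> is not
  identically zero on the axis. Near the point \<open>(x0, 0)\<close> of the axis both cofactors are units.
\<close>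

lemma dicritical_pair_normal_form:
  assumes AB: "R > 0" "A holomorphic_on ball 0 R" "B holomorphic_on ball 0 R"
    and A0: "A 0 = 0" and B0: "\<And>t. B t = 0 \<longleftrightarrow> t = 0"
    and T: "hol_germ T" "T 0 = 0" and Z: "hol_germ Z" "Z 0 = 0"
    and pair: "dicritical_pair A B T Z"
  obtains r h x0 m n v w where "r > 0" "hol_on (polydisc r) T" "hol_on (polydisc r) Z" "hol_on (polydisc r) h"
    "\<forall>q\<in>polydisc r. pullback_form A B T Z q = h q *s axis 1 1"
    "\<forall>x. norm x < r \<longrightarrow> h (vector [x, 0]) = 0" "\<forall>x. norm x < r \<longrightarrow> Z (vector [x, 0]) = 0"
    "hol_on (polydisc r) v" "\<forall>q\<in>polydisc r. T q = (q $ 2) ^ m * v q" "m > 0"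
    "hol_on (polydisc r) w" "\<forall>q\<in>polydisc r. h q = (q $ 2) ^ n * w q"
    "norm x0 < r" "v (vector [x0, 0]) \<noteq> 0" "w (vector [x0, 0]) \<noteq> 0"
proof -
  obtain h where h: "hol_germ h" "\<not> (\<forall>\<^sub>F q in nhds 0. h q = 0)"
    "\<forall>\<^sub>F q in nhds 0. pullback_form A B T Z q = h q *s axis 1 1" "\<forall>\<^sub>F x in nhds 0. h (vector [x, 0]) = 0"
    using pair unfolding dicritical_pair_def by blast
  have "((\<lambda>q :: complex ^ 2. q $ 1) \<longlongrightarrow> (0 :: complex ^ 2) $ 1) (nhds 0)"
    by (intro tendsto_vec_nth filterlim_ident)
  hence "filterlim (\<lambda>q :: complex ^ 2. q $ 1) (nhds 0) (nhds 0)" by simp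
  from eventually_compose_filterlim[OF h(4) this]
  have ax: "\<forall>\<^sub>F q in nhds (0 :: complex ^ 2). h (vector [q $ 1, 0]) = 0" .
  have "\<forall>\<^sub>F q in nhds 0. T q \<in> ball 0 R"
    by (rule topological_tendstoD[OF hol_germ_tendsto[OF T(1)] open_ball]) (use AB(1) T(2) in simp)
  with T(1)[unfolded hol_germ_iff] Z(1)[unfolded hol_germ_iff] h(1)[unfolded hol_germ_iff] h(3) ax
  have "\<forall>\<^sub>F q in nhds 0. (\<exists>G. has_gradient T G q) \<and> (\<exists>G. has_gradient Z G q) \<and> (\<exists>G. has_gradient h G q) \<and>
    pullback_form A B T Z q = h q *s axis 1 1 \<and> h (vector [q $ 1, 0]) = 0 \<and> T q \<in> ball 0 R"
    by (simp add: eventually_conj_iff)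
  then obtain r where r: "r > 0" and all: "\<forall>q\<in>polydisc r. (\<exists>G. has_gradient T G q) \<and> (\<exists>G. has_gradient Z G q) \<and>
    (\<exists>G. has_gradient h G q) \<and> pullback_form A B T Z q = h q *s axis 1 1 \<and> h (vector [q $ 1, 0]) = 0 \<and> T q \<in> ball 0 R"
    unfolding eventually_nhds_0_polydisc by blast
  have Tr: "hol_on (polydisc r) T" and Zr: "hol_on (polydisc r) Z" and hr: "hol_on (polydisc r) h"
    using all unfolding hol_on_def by blast+
  have pb: "pullback_form A B T Z q = h q *s axis 1 1" and TR: "T q \<in> ball 0 R" if "q \<in> polydisc r" for q
    using all that by blast+
  have hax: "h (vector [x, 0]) = 0" if "norm x < r" for x
    using bspec[OF all, of "vector [x, 0]"] that r by simp
  have A: "(A has_field_derivative deriv A (T q)) (at (T q))" and B: "(B has_field_derivative deriv B (T q)) (at (T q))"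
    and A': "isCont (deriv A) (T q)" if "q \<in> polydisc r" for q
    using holomorphic_derivI[OF AB(2) open_ball TR[OF that]] holomorphic_derivI[OF AB(3) open_ball TR[OF that]]
      holomorphic_on_imp_continuous_on[OF holomorphic_deriv[OF AB(2) open_ball]] TR[OF that]
    by (auto simp: continuous_on_eq_continuous_at)
  have eq1: "B (T q) * pd 1 T q + (2 * Z q + A (T q)) * pd 1 Z q = h q"
    and eq2: "B (T q) * pd 2 T q + (2 * Z q + A (T q)) * pd 2 Z q = 0" if "q \<in> polydisc r" for q
  proof -
    have *: "pullback_form A B T Z q $ i = (h q *s axis 1 1) $ i" for i using pb[OF that] by simp
    show "B (T q) * pd 1 T q + (2 * Z q + A (T q)) * pd 1 Z q = h q"
      using *[of 1] unfolding pullback_form_def differential_def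
      by (simp only: vector_add_component vector_smult_component vec_lambda_beta axis_def) simp
    show "B (T q) * pd 2 T q + (2 * Z q + A (T q)) * pd 2 Z q = 0"
      using *[of 2] unfolding pullback_form_def differential_def
      by (simp only: vector_add_component vector_smult_component vec_lambda_beta axis_def) simp
  qed
  obtain q0 where q0: "q0 \<in> polydisc r" "h q0 \<noteq> 0"
    using h(2) r unfolding eventually_nhds_0_polydisc by blast
  obtain n w x1 where w: "hol_on (polydisc r) w" "\<And>q. q \<in> polydisc r \<Longrightarrow> h q = (q $ 2) ^ n * w q"
    and x1: "norm x1 < r" "w (vector [x1, 0]) \<noteq> 0"
    using factor_second_coordinate[OF hr q0] by metis
  have "n > 0"
    using w(2)[of "vector [x1, 0]"] hax[OF x1(1)] x1 r by (cases n) auto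
  have Tax: "T (vector [x, 0]) = 0" if "norm x < r" for x
    by (rule components_vanish_on_axis(1)[OF r Tr Zr hr w(1) A A' B A0 B0 eq1 eq2 w(2) \<open>n > 0\<close> x1 Z(2)];
        (assumption | rule that))
  have Zax: "Z (vector [x, 0]) = 0" if "norm x < r" for x
    by (rule components_vanish_on_axis(2)[OF r Tr Zr hr w(1) A A' B A0 B0 eq1 eq2 w(2) \<open>n > 0\<close> x1 Z(2)];
        (assumption | rule that))
  obtain q1 where q1: "q1 \<in> polydisc r" "T q1 \<noteq> 0"
    using first_component_not_zero[OF r Tr Zr hr A B eq1 eq2 hax q0] by blast
  obtain m v x2 where v: "hol_on (polydisc r) v" "\<And>q. q \<in> polydisc r \<Longrightarrow> T q = (q $ 2) ^ m * v q"
    and x2: "norm x2 < r" "v (vector [x2, 0]) \<noteq> 0"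
    using factor_second_coordinate[OF Tr q1] by metis
  have "m > 0"
    using v(2)[of "vector [x2, 0]"] Tax[OF x2(1)] x2 r by (cases m) auto
  have "\<exists>x0. norm x0 < r \<and> v (vector [x0, 0]) * w (vector [x0, 0]) \<noteq> 0"
  proof (rule ccontr)
    assume "\<not> ?thesis"
    hence "v (vector [x, 0]) * w (vector [x, 0]) = 0" if "x \<in> ball 0 r" for x using that by simp
    from holomorphic_product_zero[OF slice_holomorphic(2)[OF v(1)] slice_holomorphic(2)[OF w(1)] this, of x1 x2]
    show False using x1 x2 r by simp
  qed
  then obtain x0 where x0: "norm x0 < r" "v (vector [x0, 0]) \<noteq> 0" "w (vector [x0, 0]) \<noteq> 0" by auto
  show thesis
    by (rule that[where n = n, OF r Tr Zr hr _ _ _ v(1) _ \<open>m > 0\<close> w(1) _ x0]) (simp_all add: pb hax Zax v(2) w(2))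
qed

text \<open>
  The point \<open>\<sigma> 0\<close> need not be the origin, so this is not a composition of germs.
\<close>

lemma hol_germ_of_hol_on_shifted:
  assumes "hol_on S H" "\<forall>\<^sub>F q in nhds 0. \<sigma> q \<in> S"
    and "\<And>q i. \<exists>G. has_gradient (\<lambda>q. \<sigma> q $ i) G q"
  shows "hol_germ (\<lambda>q. H (\<sigma> q))"
  unfolding hol_germ_iff using assms(2)
proof (rule eventually_mono)
  fix q assume "\<sigma> q \<in> S"
  have "has_gradient (\<lambda>q. \<sigma> q $ i) (differential (\<lambda>q. \<sigma> q $ i) q) q" for i
    using assms(3) by (rule has_gradient_differential)
  from has_gradient_compose[OF hol_onD[OF assms(1) \<open>\<sigma> q \<in> S\<close>] this]
  show "\<exists>G. has_gradient (\<lambda>q. H (\<sigma> q)) G q" ..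
qed

text \<open>
  Near the point \<open>(x0, 0)\<close> of the normal form, \<open>T\<close> is \<open>y\<^sup>m\<close> times a unit. The substitution
  \<open>\<sigma>(x, y) = (x0 + x, y\<^sup>k)\<close> turns it into \<open>y\<^bsup>k m\<^esup>\<close> times a unit, which is a \<open>k\<close>-th power \<open>\<mu>\<^sup>k\<close> and
  therefore equals \<open>f (\<gamma> \<mu> a)\<close>. Since the first component of \<open>\<sigma>\<close> is \<open>x\<close> up to a translation,
  \<open>h dx\<close> is pulled back to \<open>(h \<circ> \<sigma>) dx\<close>, and \<open>h \<circ> \<sigma>\<close> still vanishes exactly on the axis. The new
  base point does no harm because \<open>T\<close> and \<open>Z\<close> vanish on the whole axis.
\<close>

lemma dicritical_pair_lift:
  fixes f :: "complex ^ 2 \<Rightarrow> complex"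
  assumes AB: "R > 0" "A holomorphic_on ball 0 R" "B holomorphic_on ball 0 R"
    and A0: "A 0 = 0" and B0: "\<And>t. B t = 0 \<longleftrightarrow> t = 0"
    and T: "hol_germ T" "T 0 = 0" and Z: "hol_germ Z" "Z 0 = 0"
    and pair: "dicritical_pair A B T Z"
    and f: "hol_germ f" "f 0 = 0" "\<not> (\<forall>\<^sub>F q in nhds 0. f q = 0)"
  obtains \<phi> :: "complex ^ 2 \<Rightarrow> complex ^ 3" where "hol_map_germ \<phi>"
    "dicritical_pair A B (\<lambda>q. f (vector [\<phi> q $ 1, \<phi> q $ 2])) (\<lambda>q. \<phi> q $ 3)"
proof -
  obtain r h x0 m n v w where r: "r > 0" and hol: "hol_on (polydisc r) T" "hol_on (polydisc r) Z" "hol_on (polydisc r) h"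
    and pb: "\<forall>q\<in>polydisc r. pullback_form A B T Z q = h q *s axis 1 1"
    and hax: "\<forall>x. norm x < r \<longrightarrow> h (vector [x, 0]) = 0" and Zax: "\<forall>x. norm x < r \<longrightarrow> Z (vector [x, 0]) = 0"
    and v: "hol_on (polydisc r) v" "\<forall>q\<in>polydisc r. T q = (q $ 2) ^ m * v q" and m: "m > 0"
    and w: "hol_on (polydisc r) w" "\<forall>q\<in>polydisc r. h q = (q $ 2) ^ n * w q"
    and x0: "norm x0 < r" "v (vector [x0, 0]) \<noteq> 0" "w (vector [x0, 0]) \<noteq> 0"
    by (rule dicritical_pair_normal_form[OF AB A0 B0 T Z pair]) (rule that; assumption)
  obtain k a \<gamma> \<delta> where k: "k > 0" and \<delta>: "\<delta> > 0" and \<gamma>: "\<gamma> holomorphic_on ball 0 \<delta>" "\<gamma> 0 = 0"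
    "\<forall>s\<in>ball 0 \<delta>. f (\<gamma> s *s a) = s ^ k"
    by (rule germ_is_power_on_curve[OF f]) (rule that; assumption)
  define c where "c = v (vector [x0, 0])"
  have c: "c \<noteq> 0" using x0(2) by (simp add: c_def)
  obtain F where F: "F holomorphic_on ball c (norm c)" "\<And>u. u \<in> ball c (norm c) \<Longrightarrow> F u ^ k = u"
    using local_holomorphic_root[OF c k] by blast
  define \<sigma> :: "complex ^ 2 \<Rightarrow> complex ^ 2" where "\<sigma> q = vector [x0 + q $ 1, (q $ 2) ^ k]" for q
  define M where "M q i = (if i = 1 then axis 1 1 else (of_nat k * (q $ 2) ^ (k - 1)) *s axis 2 1 :: complex ^ 2)"
    for q :: "complex ^ 2" and i :: 2
  have \<sigma>grad: "has_gradient (\<lambda>q. \<sigma> q $ i) (M q i) q" for q i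
  proof -
    have "((\<lambda>z. z ^ k) has_field_derivative of_nat k * (q $ 2) ^ (k - 1)) (at (q $ 2))"
      by (auto intro!: derivative_eq_intros)
    from has_gradient_field_compose[OF has_gradient_coordinate this]
      has_gradient_add[OF has_gradient_const[of x0] has_gradient_coordinate[of 1 q]]
    show ?thesis using exhaust_2[of i] by (auto simp: \<sigma>_def M_def)
  qed
  have \<sigma>0: "\<sigma> 0 = vector [x0, 0]" using k by (simp add: \<sigma>_def zero_power)
  have \<sigma>lim: "(\<sigma> \<longlongrightarrow> vector [x0, 0]) (nhds 0)"
  proof -
    have q: "((\<lambda>q :: complex ^ 2. q $ i) \<longlongrightarrow> (0 :: complex ^ 2) $ i) (nhds 0)" for i
      by (intro tendsto_vec_nth filterlim_ident)
    have "((\<lambda>q :: complex ^ 2. x0 + q $ 1) \<longlongrightarrow> x0 + (0 :: complex ^ 2) $ 1) (nhds 0)"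
      by (intro tendsto_intros q)
    moreover have "((\<lambda>q :: complex ^ 2. (q $ 2) ^ k) \<longlongrightarrow> ((0 :: complex ^ 2) $ 2) ^ k) (nhds 0)"
      by (intro tendsto_intros q)
    ultimately have "((\<lambda>q :: complex ^ 2. vector [x0 + q $ 1, (q $ 2) ^ k] :: complex ^ 2) \<longlongrightarrow>
        vector [x0 + (0 :: complex ^ 2) $ 1, ((0 :: complex ^ 2) $ 2) ^ k]) (nhds 0)"
      by (rule tendsto_vector_2)
    thus ?thesis using k by (simp add: \<sigma>_def[abs_def] zero_power)
  qed
  have \<sigma>ev: "\<forall>\<^sub>F q in nhds 0. \<sigma> q \<in> polydisc r"
    by (rule topological_tendstoD[OF \<sigma>lim open_polydisc]) (use x0(1) r in simp)
  have lift: "hol_germ (\<lambda>q. H (\<sigma> q))" if "hol_on (polydisc r) H" for H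
    by (rule hol_germ_of_hol_on_shifted[OF that \<sigma>ev]) (use \<sigma>grad in blast)
  define \<mu> where "\<mu> q = (q $ 2) ^ m * F (v (\<sigma> q))" for q
  have hol_power: "hol_germ (\<lambda>q :: complex ^ 2. (q $ 2) ^ m)"
    by (rule hol_germ_field_compose[OF hol_germ_coordinate open_UNIV, where F = "\<lambda>z. z ^ m"])
       (auto intro!: holomorphic_intros)
  have Fv: "hol_germ (\<lambda>q. F (v (\<sigma> q)))"
    by (rule hol_germ_field_compose[OF lift[OF v(1)] open_ball F(1)]) (use c in \<open>simp add: \<sigma>0 c_def\<close>)
  have \<mu>: "hol_germ \<mu>" unfolding \<mu>_def by (rule hol_germ_mult[OF hol_power Fv])
  have \<mu>0: "\<mu> 0 = 0" using m by (simp add: \<mu>_def zero_power)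
  have \<gamma>\<mu>: "hol_germ (\<lambda>q. \<gamma> (\<mu> q))"
    by (rule hol_germ_field_compose[OF \<mu> open_ball \<gamma>(1)]) (use \<mu>0 \<delta> in simp)
  define \<phi> :: "complex ^ 2 \<Rightarrow> complex ^ 3" where
    "\<phi> q = vector [\<gamma> (\<mu> q) * a $ 1, \<gamma> (\<mu> q) * a $ 2, Z (\<sigma> q)]" for q
  have "hol_map_germ \<phi>"
    unfolding hol_map_germ_def
  proof
    show "\<forall>i. hol_germ (\<lambda>q. \<phi> q $ i)"
      unfolding forall_3 using hol_germ_mult[OF \<gamma>\<mu> hol_germ_const] lift[OF hol(2)] by (simp add: \<phi>_def)
    show "\<phi> 0 = 0"
      using \<gamma>(2) \<mu>0 Zax[rule_format, OF x0(1)] by (simp add: vec_eq_iff forall_3 \<phi>_def \<sigma>0)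
  qed
  moreover have "dicritical_pair A B (\<lambda>q. f (vector [\<phi> q $ 1, \<phi> q $ 2])) (\<lambda>q. \<phi> q $ 3)"
    unfolding dicritical_pair_def
  proof (intro exI[of _ "\<lambda>q. h (\<sigma> q)"] conjI)
    show "hol_germ (\<lambda>q. h (\<sigma> q))" by (rule lift[OF hol(3)])
    show "\<not> (\<forall>\<^sub>F q in nhds 0. h (\<sigma> q) = 0)"
    proof
      assume "\<forall>\<^sub>F q in nhds 0. h (\<sigma> q) = 0"
      moreover have "\<forall>\<^sub>F q in nhds 0. w (\<sigma> q) \<noteq> 0"
      proof -
        have "\<forall>\<^sub>F q in nhds 0. w (\<sigma> q) \<in> - {0}"
          by (rule topological_tendstoD[OF hol_germ_tendsto[OF lift[OF w(1)]]])
             (use x0(3) \<sigma>0 in auto)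
        thus ?thesis by simp
      qed
      ultimately have "\<forall>\<^sub>F q in nhds (0 :: complex ^ 2). q $ 2 = 0"
        using \<sigma>ev
      proof eventually_elim
        case (elim q)
        have "\<sigma> q $ 2 = 0" using bspec[OF w(2) elim(3)] elim(1,2) by auto
        thus ?case by (simp add: \<sigma>_def)
      qed
      then obtain d where d: "d > 0" "\<forall>q\<in>polydisc d. q $ 2 = 0"
        unfolding eventually_nhds_0_polydisc by blast
      have "vector [0, of_real (d/2)] \<in> polydisc d" using d(1) by simp
      from bspec[OF d(2) this] show False using d(1) by simp
    qed
    show "\<forall>\<^sub>F x in nhds 0. h (\<sigma> (vector [x, 0])) = 0"
    proof -
      have "((\<lambda>x. x0 + x) \<longlongrightarrow> x0 + 0) (nhds 0)" by (intro tendsto_intros filterlim_ident)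
      hence "\<forall>\<^sub>F x in nhds 0. x0 + x \<in> ball 0 r"
        by (rule topological_tendstoD[OF _ open_ball]) (use x0(1) in simp)
      thus ?thesis by (rule eventually_mono) (use hax k in \<open>simp add: \<sigma>_def zero_power\<close>)
    qed
    \<comment> \<open>Regrouping \<open>(y\<^sup>k)\<^sup>m\<close> as \<open>(y\<^sup>m)\<^sup>k\<close> makes \<open>T \<circ> \<sigma>\<close> the \<open>k\<close>-th power of \<open>\<mu>\<close>.\<close>
    have T\<sigma>: "\<forall>\<^sub>F q in nhds 0. T (\<sigma> q) = f (vector [\<phi> q $ 1, \<phi> q $ 2])"
    proof -
      have "\<forall>\<^sub>F q in nhds 0. \<mu> q \<in> ball 0 \<delta>"
        by (rule topological_tendstoD[OF hol_germ_tendsto[OF \<mu>] open_ball]) (use \<mu>0 \<delta> in simp)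
      moreover have "\<forall>\<^sub>F q in nhds 0. v (\<sigma> q) \<in> ball c (norm c)"
        by (rule topological_tendstoD[OF hol_germ_tendsto[OF lift[OF v(1)]] open_ball])
           (use c in \<open>simp add: \<sigma>0 c_def\<close>)
      ultimately show ?thesis using \<sigma>ev
      proof eventually_elim
        case (elim q)
        have "vector [\<phi> q $ 1, \<phi> q $ 2] = \<gamma> (\<mu> q) *s a"
          by (simp add: vec_eq_iff forall_2 \<phi>_def)
        hence "f (vector [\<phi> q $ 1, \<phi> q $ 2]) = \<mu> q ^ k" using bspec[OF \<gamma>(3) elim(1)] by simp
        also have "\<dots> = ((q $ 2) ^ k) ^ m * v (\<sigma> q)"
          unfolding \<mu>_def power_mult_distrib F(2)[OF elim(2)] by (simp add: power_mult[symmetric] mult.commute)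
        also have "\<dots> = T (\<sigma> q)" using bspec[OF v(2) elim(3)] by (simp add: \<sigma>_def)
        finally show ?case by simp
      qed
    qed
    have Z\<sigma>: "\<forall>\<^sub>F q in nhds 0. Z (\<sigma> q) = \<phi> q $ 3" by (simp add: \<phi>_def)
    show "\<forall>\<^sub>F q in nhds 0. pullback_form A B (\<lambda>q. f (vector [\<phi> q $ 1, \<phi> q $ 2])) (\<lambda>q. \<phi> q $ 3) q =
        h (\<sigma> q) *s axis 1 1"
      using pullback_form_cong[OF T\<sigma> Z\<sigma>, of A B] \<sigma>ev
    proof eventually_elim
      case (elim q)
      note form = bspec[OF pb elim(2)]
      have "pullback_form A B (\<lambda>q. T (\<sigma> q)) (\<lambda>q. Z (\<sigma> q)) q =
          pullback \<sigma> (\<lambda>q. pullback_form A B T Z q) q"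
        by (rule pullback_pullback_form[where \<phi> = \<sigma> and q = q and
              \<omega> = "\<lambda>q. pullback_form A B T Z q", OF hol_onD[OF hol(1) elim(2)] hol_onD[OF hol(2) elim(2)] \<sigma>grad refl, symmetric])
      also have "\<dots> = h (\<sigma> q) *s axis 1 1"
        unfolding pullback_def form has_gradient_imp_differential[OF \<sigma>grad]
        by (simp add: sum_2 M_def axis_def vec_eq_iff)
      finally show ?case using elim(1) by simp
    qed
  qed
  ultimately show thesis by (rule that)
qed

section \<open>The two foliations\<close>

lemma differential_cusp:
  assumes "has_gradient T G q" "has_gradient Z H q"
  shows "differential (\<lambda>q. (Z q)\<^sup>2 + T q ^ N) q = (of_nat N * T q ^ (N - 1)) *s G + (2 * Z q) *s H"
proof -
  have "((\<lambda>z. z\<^sup>2) has_field_derivative 2 * Z q) (at (Z q))"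
    "((\<lambda>t. t ^ N) has_field_derivative of_nat N * T q ^ (N - 1)) (at (T q))"
    by (auto intro!: derivative_eq_intros)
  from has_gradient_imp_differential[OF has_gradient_add[OF has_gradient_field_compose[OF assms(2) this(1)]
      has_gradient_field_compose[OF assms(1) this(2)]]]
  show ?thesis by (simp add: add.commute)
qed

definition dz_perturbation :: "nat \<Rightarrow> complex \<Rightarrow> complex fps \<Rightarrow> complex \<Rightarrow> complex" where
  "dz_perturbation p \<alpha> U t = \<alpha> * t ^ p * eval_fps U t"

definition dt_coefficient :: "nat \<Rightarrow> complex \<Rightarrow> complex" where
  "dt_coefficient p t = of_nat (2 * p) * t ^ (2 * p - 1)"

lemma coefficients_holomorphic:
  assumes "fps_conv_radius U > 0"
  obtains R where "R > 0" "dz_perturbation p \<alpha> U holomorphic_on ball 0 R" "dt_coefficient p holomorphic_on ball 0 R"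
proof -
  obtain R where R: "0 < ereal R" "ereal R < fps_conv_radius U" using ereal_dense2[OF assms] by blast
  have "ball 0 R \<subseteq> eball (0::complex) (fps_conv_radius U)"
  proof
    fix x :: complex assume "x \<in> ball 0 R"
    hence "ereal (norm x) < ereal R" by simp
    also note R(2)
    finally show "x \<in> eball 0 (fps_conv_radius U)" by (simp add: in_eball_iff)
  qed
  hence "dz_perturbation p \<alpha> U holomorphic_on ball 0 R"
    unfolding dz_perturbation_def by (intro holomorphic_intros)
  moreover have "dt_coefficient p holomorphic_on ball 0 R" unfolding dt_coefficient_def by (intro holomorphic_intros)
  ultimately show thesis using that R(1) by simp
qed

lemma form\<omega>_eq_pullback_form:
  "form\<omega> p \<alpha> U q = pullback_form (dz_perturbation p \<alpha> U) (dt_coefficient p) (\<lambda>q. q $ 1) (\<lambda>q. q $ 2) q"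
  unfolding form\<omega>_def pullback_form_def differential_coordinate
    differential_cusp[OF has_gradient_coordinate has_gradient_coordinate]
  by (simp add: dz_perturbation_def dt_coefficient_def vec_eq_iff algebra_simps)

lemma form\<Omega>_eq_pullback_form:
  assumes "has_gradient f G (vector [q $ 1, q $ 2])"
  shows "form\<Omega> p \<alpha> U f q =
    pullback_form (dz_perturbation p \<alpha> U) (dt_coefficient p) (\<lambda>q. f (vector [q $ 1, q $ 2])) (\<lambda>q. q $ 3) q"
  unfolding form\<Omega>_def Let_def pullback_form_def differential_coordinate
    differential_cusp[OF has_gradient_of_first_two_coordinates[OF assms] has_gradient_coordinate]
    has_gradient_imp_differential[OF has_gradient_of_first_two_coordinates[OF assms]]
  by (simp add: dz_perturbation_def dt_coefficient_def vec_eq_iff algebra_simps)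

theorem theorem7:
  fixes p :: nat and \<alpha> :: complex and U :: "complex fps"
    and f :: "complex ^ 2 \<Rightarrow> complex"
  assumes "p > 0" and "\<alpha> \<noteq> 0"
    and "fps_conv_radius U > 0" and "fps_nth U 0 = 1"
    and "hol_germ f" and "f 0 = 0" and "\<not> (\<forall>\<^sub>F q in nhds 0. f q = 0)"
  shows "dicritical (form\<Omega> p \<alpha> U f) \<longleftrightarrow> dicritical (form\<omega> p \<alpha> U)"
  proof -
  let ?A = "dz_perturbation p \<alpha> U" and ?B = "dt_coefficient p"
  let ?F = "\<lambda>q :: complex ^ 3. f (vector [q $ 1, q $ 2])"
  obtain R where R: "R > 0" "?A holomorphic_on ball 0 R" "?B holomorphic_on ball 0 R"
    using coefficients_holomorphic[OF assms(3)] by blast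
  have A0: "?A 0 = 0" using assms(1) by (simp add: dz_perturbation_def zero_power)
  have B0: "?B t = 0 \<longleftrightarrow> t = 0" for t using assms(1) by (auto simp: dt_coefficient_def)
  have q: "((\<lambda>q :: complex ^ 3. q $ i) \<longlongrightarrow> (0 :: complex ^ 3) $ i) (nhds 0)" for i
    by (intro tendsto_vec_nth filterlim_ident)
  have "filterlim (\<lambda>q :: complex ^ 3. vector [q $ 1, q $ 2] :: complex ^ 2) (nhds 0) (nhds 0)"
    using tendsto_vector_2[OF q[of 1] q[of 2]] by (simp add: vector_2_zero)
  from eventually_compose_filterlim[OF assms(5)[unfolded hol_germ_iff] this]
  have grad: "\<forall>\<^sub>F q :: complex ^ 3 in nhds 0. \<exists>G. has_gradient f G (vector [q $ 1, q $ 2])" .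
  have F: "hol_germ ?F"
    unfolding hol_germ_iff using grad by (rule eventually_mono) (blast intro: has_gradient_of_first_two_coordinates)
  have F0: "?F 0 = 0" using assms(6) by (simp add: vector_2_zero)
  have F3: "\<forall>\<^sub>F q in nhds 0. pd 3 ?F q = 0"
    using grad
  proof (rule eventually_mono)
    fix q :: "complex ^ 3"
    assume "\<exists>G. has_gradient f G (vector [q $ 1, q $ 2])"
    then obtain G where "has_gradient f G (vector [q $ 1, q $ 2])" ..
    from has_gradient_imp_pd[OF has_gradient_of_first_two_coordinates[OF this], of 3]
    show "pd 3 ?F q = 0" by (simp add: axis_def)
  qed
  have \<Omega>: "\<forall>\<^sub>F q in nhds 0. form\<Omega> p \<alpha> U f q = pullback_form ?A ?B ?F (\<lambda>q. q $ 3) q"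
    using grad by (rule eventually_mono) (blast intro: form\<Omega>_eq_pullback_form)
  have \<omega>: "\<forall>\<^sub>F q in nhds 0. form\<omega> p \<alpha> U q = pullback_form ?A ?B (\<lambda>q. q $ 1) (\<lambda>q. q $ 2) q"
    by (simp add: form\<omega>_eq_pullback_form)
  have "foliation_form (form\<Omega> p \<alpha> U f)"
    by (rule foliation_form_pullback_form[OF R F F0 F3 \<Omega>])
  moreover have "foliation_form (form\<omega> p \<alpha> U)"
    by (rule foliation_form_pullback_form[OF R hol_germ_coordinate _ _ \<omega>])
       (simp_all add: has_gradient_imp_pd[OF has_gradient_coordinate] axis_def)
  moreover have "(\<exists>\<phi> :: complex ^ 2 \<Rightarrow> complex ^ 3. hol_map_germ \<phi> \<and> dicritical_pair ?A ?B (\<lambda>q. ?F (\<phi> q)) (\<lambda>q. \<phi> q $ 3)) \<longleftrightarrow>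
     (\<exists>\<psi> :: complex ^ 2 \<Rightarrow> complex ^ 2. hol_map_germ \<psi> \<and> dicritical_pair ?A ?B (\<lambda>q. \<psi> q $ 1) (\<lambda>q. \<psi> q $ 2))"
    (is "?L \<longleftrightarrow> ?R")
  proof
    assume ?L
    then obtain \<phi> :: "complex ^ 2 \<Rightarrow> complex ^ 3" where \<phi>: "hol_map_germ \<phi>"
      "dicritical_pair ?A ?B (\<lambda>q. ?F (\<phi> q)) (\<lambda>q. \<phi> q $ 3)" by blast
    define \<psi> where "\<psi> q = (vector [?F (\<phi> q), \<phi> q $ 3] :: complex ^ 2)" for q
    have "hol_map_germ \<psi>"
      using hol_germ_compose[OF F \<phi>(1)] \<phi>(1) F0
      by (auto simp: hol_map_germ_def \<psi>_def forall_2 vec_eq_iff)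
    moreover have "dicritical_pair ?A ?B (\<lambda>q. \<psi> q $ 1) (\<lambda>q. \<psi> q $ 2)"
      using \<phi>(2) by (simp add: \<psi>_def)
    ultimately show ?R by blast
  next
    assume ?R
    then obtain \<psi> :: "complex ^ 2 \<Rightarrow> complex ^ 2" where \<psi>: "hol_map_germ \<psi>"
      "dicritical_pair ?A ?B (\<lambda>q. \<psi> q $ 1) (\<lambda>q. \<psi> q $ 2)" by blast
    have comp: "hol_germ (\<lambda>q. \<psi> q $ i)" "\<psi> 0 $ i = 0" for i
      using \<psi>(1) by (auto simp: hol_map_germ_def)
    show ?L
      by (rule dicritical_pair_lift[OF R A0 B0 comp comp \<psi>(2) assms(5-7)]) blast
  qed
  ultimately show ?thesis
    unfolding dicritical_iff_pair[OF F hol_germ_coordinate \<Omega>]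
      dicritical_iff_pair[OF hol_germ_coordinate hol_germ_coordinate \<omega>] by simp
qed

end
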